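(* Let $a>0$ and let $k$ be a non-negative integer. Define \[J_{2k+1}(a)=\int_0^\infty\frac{x\,e^{-\pi a x^2}}{e^{2\pi x}-1}\,{}_1F_1\!\left(-2k-1;\tfrac{3}{2};2\pi a x^2\right)dx .\] Then \[J_{2k+1}(a)=-T_{2k+1}(a)+\epsilon_{2k+1}(a),\] where \[T_{2k+1}(a)=\frac{1}{4\pi a}\left\{\left(\frac{1-a^{1/2}}{2}\right)\sqrt{\frac{\pi}{2}}\,\frac{\Gamma(2k+2)}{\Gamma(2k+\frac{5}{2})}+{}_2F_1\!\left(-2k-1,1;\tfrac{3}{2};2\right)\right\}\] and \[\epsilon_{2k+1}(a)=\frac{1}{4\pi a}\int_1^\infty \{a^{1/2}\phi(t)-\psi(t)\}\,\frac{(t-1)^{2k+1}}{(1+t)^{2k+5/2}}\,dt,\] with $\psi(t)=\sum_{n\ge1}e^{-\pi n^2 t/a}$ and $\phi(t)=\sum_{n\ge1}e^{-\pi n^2 a t}$.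
   Context: ${}_1F_1$ denotes Kummer's confluent hypergeometric function and ${}_2F_1$ the Gauss hypergeometric function; for negative integer first parameter both series terminate. *)

theory Defs
  imports "HOL-Analysis.Analysis"
begin

text \<open>Kummer's confluent hypergeometric series 1F1(a;b;z) = sum_n (a)_n/(b)_n z^n/n!.
  For a a negative integer it terminates, so the suminf is a finite sum.\<close>
definition hyp1F1 :: "real \<Rightarrow> real \<Rightarrow> real \<Rightarrow> real" where
  "hyp1F1 a b z = (\<Sum>n. pochhammer a n / pochhammer b n * z ^ n / fact n)"

definition hyp2F1 :: "real \<Rightarrow> real \<Rightarrow> real \<Rightarrow> real \<Rightarrow> real" where
  "hyp2F1 a b c z = (\<Sum>n. pochhammer a n * pochhammer b n / pochhammer c n * z ^ n / fact n)"

definition psi_theta :: "real \<Rightarrow> real \<Rightarrow> real" where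
  "psi_theta a t = (\<Sum>n. exp (- pi * (real (Suc n))^2 * t / a))"

definition phi_theta :: "real \<Rightarrow> real \<Rightarrow> real" where
  "phi_theta a t = (\<Sum>n. exp (- pi * (real (Suc n))^2 * a * t))"

definition J_int :: "nat \<Rightarrow> real \<Rightarrow> real" where
  "J_int k a = (LBINT x:{0<..}. x * exp (- pi * a * x^2) / (exp (2 * pi * x) - 1)
       * hyp1F1 (- (2 * real k + 1)) (3/2) (2 * pi * a * x^2))"

definition T_term :: "nat \<Rightarrow> real \<Rightarrow> real" where
  "T_term k a = 1 / (4 * pi * a) *
     ((1 - sqrt a) / 2 * sqrt (pi / 2) * Gamma (2 * real k + 2) / Gamma (2 * real k + 5/2)
      + hyp2F1 (- (2 * real k + 1)) 1 (3/2) 2)"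

definition eps_term :: "nat \<Rightarrow> real \<Rightarrow> real" where
  "eps_term k a = 1 / (4 * pi * a) *
     (LBINT t:{1..}. (sqrt a * phi_theta a t - psi_theta a t)
        * (t - 1) ^ (2 * k + 1) / (1 + t) powr (2 * real k + 5/2))"

end

theory Submission
  imports Defs "HOL-Probability.Characteristic_Functions" "HOL-Probability.Sinc_Integral"
begin

text \<open>Put \<open>\<Theta>(s) = 1/2 + \<Sum>n\<ge>1. exp (- \<pi> n\<^sup>2 a s)\<close>, half of the Jacobi theta function. The partial
  fraction expansion of the hyperbolic cotangent says that \<open>x / (exp (2 \<pi> x) - 1) + x / 2\<close> is
  \<open>a x\<^sup>2\<close> times the Laplace transform of \<open>\<Theta>\<close> at \<open>\<pi> a x\<^sup>2\<close>. On the other hand, integrating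
  \<open>x\<^sup>2 exp (- \<pi> a (1 + s) x\<^sup>2) 1F1(-m; 3/2; 2 \<pi> a x\<^sup>2)\<close> term by term gives a multiple of
  \<open>w(s) = (s - 1)^m / (1 + s)^(m + 3/2)\<close>. By Fubini, the integral in question is a multiple of
  \<open>\<integral> \<Theta>(s) w(s) ds\<close> over \<open>(0, \<infinity>)\<close>, minus the contribution of \<open>x / 2\<close>, which is the 2F1 term.
  The inversion formula of the theta function and \<open>w(1/t) = (-1)^m t^(3/2) w(t)\<close> fold \<open>(0, 1)\<close> onto
  \<open>(1, \<infinity>)\<close>; the constant terms \<open>1/2\<close> produce a Beta integral, hence the quotient of Gamma values.

  Both the partial fractions and the theta inversion come from one fact: a continuous function on
  \<open>[0, 1]\<close>, symmetric about \<open>1/2\<close> and with summable cosine coefficients, is the sum of its cosine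
  series. It is applied to \<open>cosh (2 \<pi> y (x - 1/2))\<close> and to a periodised Gaussian.\<close>

section \<open>Cosine series\<close>

text \<open>One more factor \<open>cos (2 * pi * x)\<close> splits frequency \<open>k\<close> into
  \<open>k + 1\<close> and \<open>k - 1\<close>, so the induction on \<open>j\<close> must carry all
  frequencies at once. The outcome is orthogonality of \<open>g\<close> to every polynomial in
  \<open>cos (2 * pi * x)\<close>.\<close>

lemma integral_mult_cos_power_eq_0:
  fixes g :: "real \<Rightarrow> real"
  assumes cont: "continuous_on {0..1} g"
    and zero: "\<And>k::nat. integral {0..1} (\<lambda>x. g x * cos (2 * pi * real k * x)) = 0"
  shows "integral {0..1} (\<lambda>x. g x * cos (2 * pi * x) ^ j * cos (2 * pi * real k * x)) = 0"
proof (induction j arbitrary: k)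
  case 0
  then show ?case using zero by simp
next
  case (Suc j)
  define f where "f l x = g x * cos (2 * pi * x) ^ j * cos (2 * pi * real l * x)" for l x
  have int: "f l integrable_on {0..1}" for l
    unfolding f_def by (intro integrable_continuous_interval continuous_intros cont)
  have eq0: "integral {0..1} (f l) = 0" for l
    using Suc[of l] by (simp add: f_def[abs_def])
  show ?case
  proof (cases k)
    \<comment> \<open>At frequency 0 there is no lower neighbour; the additional cosine is itself
      the mode of frequency 1.\<close>
    case 0
    then show ?thesis
      using eq0[of 1] by (simp add: f_def[abs_def] mult_ac)
  next
    case (Suc l)
    have "cos (2 * pi * x) * cos (2 * pi * real k * x)
        = (cos (2 * pi * real (Suc k) * x) + cos (2 * pi * real l * x)) / 2" for x
      by (subst cos_times_cos) (simp add: Suc algebra_simps add_ac cos_diff)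
    moreover have "g x * cos (2 * pi * x) ^ Suc j * cos (2 * pi * real k * x)
        = g x * cos (2 * pi * x) ^ j * (cos (2 * pi * x) * cos (2 * pi * real k * x))" for x
      by (simp add: mult_ac)
    ultimately have "(\<lambda>x. g x * cos (2 * pi * x) ^ Suc j * cos (2 * pi * real k * x))
        = (\<lambda>x. (f (Suc k) x + f l x) / 2)"
      by (simp add: f_def fun_eq_iff distrib_left add_divide_distrib)
    then show ?thesis
      by (simp add: integral_add[OF int int] eq0)
  qed
qed

lemma cosine_coeffs_eq_0_imp_eq_0:
  fixes g :: "real \<Rightarrow> real"
  assumes cont: "continuous_on {0..1} g"
    and sym: "\<And>x. x \<in> {0..1} \<Longrightarrow> g (1 - x) = g x"
    and zero: "\<And>k::nat. integral {0..1} (\<lambda>x. g x * cos (2 * pi * real k * x)) = 0"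
    and x: "x \<in> {0..1}"
  shows "g x = 0"
proof -
  \<comment> \<open>By symmetry \<open>g\<close> is a function of \<open>cos (2 * pi * x)\<close>, so polynomials in it approximate \<open>g\<close>.\<close>
  define H where "H y = g (arccos y / (2 * pi))" for y
  have contH: "continuous_on {-1..1} H"
    unfolding H_def
    by (intro continuous_on_compose2[OF cont] continuous_intros)
       (use arccos_lbound arccos_ubound in \<open>auto simp: divide_simps\<close>, smt (verit) arccos_ubound pi_gt_zero)
  have H: "H (cos (2 * pi * x)) = g x" if "x \<in> {0..1}" for x
  proof (cases "x \<le> 1/2")
    case True
    have "2 * pi * x \<le> 2 * pi * (1/2)" by (intro mult_left_mono True) auto
    with that have "arccos (cos (2 * pi * x)) = 2 * pi * x"
      by (intro arccos_cos) auto
    then show ?thesis by (simp add: H_def)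
  next
    case False
    have "2 * pi * (1 - x) \<le> 2 * pi * (1/2)" by (intro mult_left_mono) (use False in auto)
    with that have "arccos (cos (2 * pi * (1 - x))) = 2 * pi * (1 - x)"
      by (intro arccos_cos) auto
    moreover have "cos (2 * pi * (1 - x)) = cos (2 * pi * x)"
      by (simp add: cos_diff right_diff_distrib)
    ultimately have "H (cos (2 * pi * x)) = g (1 - x)" by (simp add: H_def)
    with sym[OF that] show ?thesis by simp
  qed
  define B where "B = integral {0..1} (\<lambda>x. \<bar>g x\<bar>)"
  have B: "B \<ge> 0" unfolding B_def by (intro integral_nonneg integrable_continuous_interval continuous_intros cont) auto
  \<comment> \<open>Orthogonality lets any polynomial in \<open>cos (2 * pi * x)\<close> be
    subtracted from one factor \<open>g\<close>. With uniform error \<open>d\<close>, the square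
    integral is then at most \<open>d\<close> times the L1 norm \<open>B\<close>.\<close>
  have "integral {0..1} (\<lambda>x. g x * g x) \<le> 0"
  proof (rule field_le_epsilon)
    fix e :: real assume e: "e > 0"
    \<comment> \<open>The summand 1 keeps the denominator positive when \<open>B\<close> is
      0.\<close>
    define d where "d = e / (B + 1)"
    have d: "d > 0" using e B by (simp add: d_def)
    obtain p where p: "real_polynomial_function p" "\<And>y. y \<in> {-1..1} \<Longrightarrow> \<bar>H y - p y\<bar> < d"
      by (rule Stone_Weierstrass_real_polynomial_function[OF _ contH d]) auto
    obtain a n where an: "p = (\<lambda>y. \<Sum>i\<le>n. a i * y ^ i)"
      using p(1) real_polynomial_function_iff_sum by blast
    let ?p = "\<lambda>x. \<Sum>i\<le>n. a i * (g x * cos (2 * pi * x) ^ i * cos (2 * pi * real 0 * x))"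
    have p0: "integral {0..1} ?p = 0"
      by (subst integral_sum) (auto intro!: integrable_continuous_interval continuous_intros cont
            simp: integral_mult_cos_power_eq_0[OF cont zero, of _ 0, simplified])
    have "integral {0..1} (\<lambda>x. g x * g x) = integral {0..1} (\<lambda>x. g x * g x - ?p x)"
      by (subst integral_diff) (auto intro!: integrable_continuous_interval continuous_intros cont simp: p0[simplified])
    also have "\<dots> \<le> integral {0..1} (\<lambda>x. \<bar>g x\<bar> * d)"
    proof (intro integral_le integrable_continuous_interval continuous_intros cont)
      fix x :: real assume x: "x \<in> {0..1}"
      have "?p x = g x * p (cos (2 * pi * x))"
        by (simp add: an sum_distrib_left mult_ac)
      then have "g x * g x - ?p x = g x * (H (cos (2 * pi * x)) - p (cos (2 * pi * x)))"
        by (simp only: H[OF x] right_diff_distrib)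
      also have "\<dots> \<le> \<bar>g x\<bar> * \<bar>H (cos (2 * pi * x)) - p (cos (2 * pi * x))\<bar>"
        by (metis abs_ge_self abs_mult)
      also have "\<dots> \<le> \<bar>g x\<bar> * d"
        using p(2)[of "cos (2 * pi * x)"] by (intro mult_left_mono) (auto simp: less_imp_le)
      finally show "g x * g x - ?p x \<le> \<bar>g x\<bar> * d" .
    qed
    also have "\<dots> = B * d" by (simp add: B_def)
    also have "\<dots> \<le> 0 + e" using e B by (simp add: d_def field_simps)
    finally show "integral {0..1} (\<lambda>x. g x * g x) \<le> 0 + e" .
  qed
  moreover have "integral {0..1} (\<lambda>x. g x * g x) \<ge> 0"
    by (intro integral_nonneg integrable_continuous_interval continuous_intros cont) auto
  moreover have "(\<lambda>x. g x * g x) integrable_on {0..1}"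
    by (intro integrable_continuous_interval continuous_intros cont)
  ultimately have "((\<lambda>x. g x * g x) has_integral 0) (cbox 0 1)"
    using integrable_integral by fastforce
  then have "g x * g x = 0"
    by (rule has_integral_0_cbox_imp_0[rotated 2]) (use x cont in \<open>auto intro!: continuous_intros\<close>)
  then show ?thesis by simp
qed

lemma integral_cos_times_cos:
  fixes j k :: nat
  shows "integral {0..1} (\<lambda>x. cos (2 * pi * real j * x) * cos (2 * pi * real k * x))
    = (if j = k then if k = 0 then 1 else 1/2 else 0)"
proof -
  \<comment> \<open>Integer frequencies, because the product formula produces \<open>j - k\<close>,
    which may be negative.\<close>
  have *: "((\<lambda>x. cos (2 * pi * of_int n * x)) has_integral (if n = 0 then 1 else 0)) {0..1}" for n :: int
  proof (cases "n = 0")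
    case True
    then show ?thesis using has_integral_const_real[of "1::real" 0 1] by simp
  next
    case False
    have "((\<lambda>x. cos (2 * pi * of_int n * x)) has_integral
        (sin (2 * pi * of_int n * 1) / (2 * pi * of_int n) - sin (2 * pi * of_int n * 0) / (2 * pi * of_int n))) {0..1}"
      by (rule fundamental_theorem_of_calculus)
         (use False in \<open>auto intro!: derivative_eq_intros simp: has_real_derivative_iff_has_vector_derivative[symmetric]\<close>)
    moreover have "sin (2 * pi * of_int n) = 0"
      using sin_integer_2pi[of "of_int n"] by simp
    ultimately show ?thesis using False by simp
  qed
  have eq: "(\<lambda>x. cos (2 * pi * real j * x) * cos (2 * pi * real k * x))
    = (\<lambda>x. (cos (2 * pi * of_int (int j - int k) * x) + cos (2 * pi * of_int (int j + int k) * x)) / 2)"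
    by (auto simp: cos_times_cos fun_eq_iff algebra_simps)
  have "((\<lambda>x. cos (2 * pi * real j * x) * cos (2 * pi * real k * x)) has_integral
     ((if int j - int k = 0 then 1 else 0) + (if int j + int k = 0 then 1 else 0)) / 2) {0..1}"
    unfolding eq by (intro has_integral_divide has_integral_add *)
  then show ?thesis by (auto dest: integral_unique)
qed

text \<open>Absolute summability makes the cosine series converge uniformly to a continuous
  symmetric function with the same coefficients as \<open>f\<close>; the uniqueness lemma applies to
  the difference.\<close>

theorem cosine_series_eq:
  fixes f :: "real \<Rightarrow> real" and c :: "nat \<Rightarrow> real"
  assumes cont: "continuous_on {0..1} f"
    and sym: "\<And>x. x \<in> {0..1} \<Longrightarrow> f (1 - x) = f x"
    and coeff: "\<And>k. integral {0..1} (\<lambda>x. f x * cos (2 * pi * real k * x)) = c k"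
    and summ: "summable (\<lambda>k. \<bar>c k\<bar>)"
    and x: "x \<in> {0..1}"
  shows "f x = c 0 + 2 * (\<Sum>k. c (Suc k) * cos (2 * pi * real (Suc k) * x))"
proof -
  \<comment> \<open>The square of a cosine mode has mean 1 at frequency 0 and 1/2 otherwise, hence
    the factor 2.\<close>
  define b where "b k = (if k = 0 then c k else 2 * c k)" for k
  define S where "S x = (\<Sum>k. b k * cos (2 * pi * real k * x))" for x
  have summ_b: "summable (\<lambda>k. \<bar>b k\<bar>)"
    by (rule summable_comparison_test'[OF summable_mult[OF summ, of 2], of 0]) (auto simp: b_def)
  have bound: "norm (b k * cos (2 * pi * real k * x)) \<le> \<bar>b k\<bar>" for k x
    by (simp add: abs_mult mult_left_le)
  have summ_S: "summable (\<lambda>k. b k * cos (2 * pi * real k * x))" for x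
    by (rule summable_comparison_test'[OF summ_b, of 0]) (use bound in auto)
  have lim: "uniform_limit {0..1} (\<lambda>n x. \<Sum>k<n. b k * cos (2 * pi * real k * x)) S sequentially"
    unfolding S_def by (rule Weierstrass_m_test[OF bound summ_b])
  have contS: "continuous_on {0..1} S"
    by (rule uniform_limit_theorem[OF _ lim]) (auto intro!: continuous_intros always_eventually)
  have coeffS: "integral {0..1} (\<lambda>x. S x * cos (2 * pi * real j * x)) = c j" for j
  proof -
    have lim': "uniform_limit {0..1} (\<lambda>n x. (\<Sum>k<n. b k * cos (2 * pi * real k * x)) * cos (2 * pi * real j * x))
        (\<lambda>x. S x * cos (2 * pi * real j * x)) sequentially"
    proof (rule uniform_lim_mult[OF lim uniform_limit_const])
      show "bounded (S ` {0..1})"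
        by (intro compact_imp_bounded compact_continuous_image contS) auto
      show "bounded ((\<lambda>x. cos (2 * pi * real j * x)) ` {0..1})"
        by (intro compact_imp_bounded compact_continuous_image continuous_intros) auto
    qed
    obtain I K where IK: "\<And>n. ((\<lambda>x. (\<Sum>k<n. b k * cos (2 * pi * real k * x)) * cos (2 * pi * real j * x)) has_integral I n) {0..1}"
        "((\<lambda>x. S x * cos (2 * pi * real j * x)) has_integral K) {0..1}" "I \<longlonglongrightarrow> K"
      by (rule uniform_limit_integral[OF lim']) (auto intro!: continuous_intros)
    \<comment> \<open>Once the partial sum contains mode \<open>j\<close>, its \<open>j\<close>-th
      coefficient no longer changes, so the limit is read off.\<close>
    have "I n = c j" if "n > j" for n
    proof -
      have "I n = integral {0..1} (\<lambda>x. \<Sum>k<n. b k * (cos (2 * pi * real k * x) * cos (2 * pi * real j * x)))"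
        using integral_unique[OF IK(1)[of n]] by (simp add: sum_distrib_right mult.assoc)
      also have "\<dots> = (\<Sum>k<n. b k * (if k = j then if j = 0 then 1 else 1/2 else 0))"
        by (subst integral_sum) (auto intro!: integrable_continuous_interval continuous_intros sum.cong
            simp: integral_cos_times_cos)
      also have "\<dots> = (\<Sum>k<n. if k = j then c j else 0)"
        by (intro sum.cong) (auto simp: b_def)
      also have "\<dots> = c j" using that by simp
      finally show ?thesis .
    qed
    then have "I \<longlonglongrightarrow> c j"
      by (intro tendsto_eventually) (auto simp: eventually_at_top_dense)
    with IK(3) have "K = c j" by (rule LIMSEQ_unique)
    with IK(2) show ?thesis by (simp add: integral_unique)
  qed
  have symS: "S (1 - x) = S x" for x
  proof -
    have "cos (2 * pi * real k * (1 - x)) = cos (2 * pi * real k * x)" for k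
    proof -
      have "cos (2 * pi * real k * (1 - x)) = cos (2 * pi * real k - 2 * pi * real k * x)"
        by (simp add: algebra_simps)
      also have "\<dots> = cos (2 * pi * real k * x)"
        using cos_2npi[of k] sin_2npi[of k] by (simp add: cos_diff mult_ac)
      finally show ?thesis .
    qed
    then show ?thesis by (simp add: S_def)
  qed
  have "f x - S x = 0"
  proof (rule cosine_coeffs_eq_0_imp_eq_0[of "\<lambda>x. f x - S x", OF _ _ _ x])
    show "integral {0..1} (\<lambda>x. (f x - S x) * cos (2 * pi * real k * x)) = 0" for k
      unfolding left_diff_distrib
      by (subst integral_diff) (auto intro!: integrable_continuous_interval continuous_intros cont contS simp: coeff coeffS)
  qed (auto intro!: continuous_intros cont contS simp: sym symS)
  then have "f x = S x" by simp
  also have "\<dots> = c 0 + (\<Sum>k. b (Suc k) * cos (2 * pi * real (Suc k) * x))"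
    unfolding S_def using suminf_split_head[OF summ_S[of x]] by (simp add: b_def)
  also have "(\<Sum>k. b (Suc k) * cos (2 * pi * real (Suc k) * x)) = (\<Sum>k. 2 * (c (Suc k) * cos (2 * pi * real (Suc k) * x)))"
    by (simp add: b_def mult.assoc)
  also have "\<dots> = 2 * (\<Sum>k. c (Suc k) * cos (2 * pi * real (Suc k) * x))"
  proof (rule suminf_mult)
    have "summable (\<lambda>k. b (Suc k) * cos (2 * pi * real (Suc k) * x) / 2)"
      using summ_S[of x] by (subst (asm) summable_Suc_iff[symmetric]) (rule summable_divide)
    then show "summable (\<lambda>k. c (Suc k) * cos (2 * pi * real (Suc k) * x))"
      by (simp add: b_def)
  qed
  finally show ?thesis .
qed

section \<open>Cosine coefficients of the hyperbolic cosine and of the Gaussian\<close>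

lemma has_integral_cosh_times_cos:
  fixes y :: real and k :: nat
  assumes "y > 0"
  shows "((\<lambda>x. cosh (2 * pi * y * (x - 1/2)) * cos (2 * pi * real k * x))
    has_integral (sinh (pi * y) / pi * (y / (y^2 + real k^2)))) {0..1}"
proof -
  define D where "D = 2 * pi * (y^2 + real k^2)"
  have "y^2 + real k^2 > 0" using assms by (intro add_pos_nonneg) auto
  then have "D > 0" unfolding D_def by (intro mult_pos_pos) auto
  then have D: "D \<noteq> 0" by simp
  \<comment> \<open>The antiderivative that two integrations by parts give. At 0 and 1 its sine term
    vanishes, and oddness of \<open>sinh\<close> doubles the rest.\<close>
  define F where "F x = (y * sinh (2 * pi * y * (x - 1/2)) * cos (2 * pi * real k * x)
      + real k * cosh (2 * pi * y * (x - 1/2)) * sin (2 * pi * real k * x)) / D" for x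
  have "((\<lambda>x. cosh (2 * pi * y * (x - 1/2)) * cos (2 * pi * real k * x)) has_integral (F 1 - F 0)) {0..1}"
  proof (rule fundamental_theorem_of_calculus)
    fix x :: real
    have "(F has_real_derivative ((y * (cosh (2 * pi * y * (x - 1/2)) * (2 * pi * y)) * cos (2 * pi * real k * x)
        - y * sinh (2 * pi * y * (x - 1/2)) * (sin (2 * pi * real k * x) * (2 * pi * real k))
        + (real k * (sinh (2 * pi * y * (x - 1/2)) * (2 * pi * y)) * sin (2 * pi * real k * x)
        + real k * cosh (2 * pi * y * (x - 1/2)) * (cos (2 * pi * real k * x) * (2 * pi * real k)))) / D))
         (at x within {0..1})"
      unfolding F_def by (rule DERIV_cdivide) (rule derivative_eq_intros refl | simp)+
    also have "((y * (cosh (2 * pi * y * (x - 1/2)) * (2 * pi * y)) * cos (2 * pi * real k * x)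
        - y * sinh (2 * pi * y * (x - 1/2)) * (sin (2 * pi * real k * x) * (2 * pi * real k))
        + (real k * (sinh (2 * pi * y * (x - 1/2)) * (2 * pi * y)) * sin (2 * pi * real k * x)
        + real k * cosh (2 * pi * y * (x - 1/2)) * (cos (2 * pi * real k * x) * (2 * pi * real k)))))
        = cosh (2 * pi * y * (x - 1/2)) * cos (2 * pi * real k * x) * D"
      unfolding D_def by (simp only: ring_distribs power2_eq_square) (simp add: mult_ac)
    finally show "(F has_vector_derivative cosh (2 * pi * y * (x - 1/2)) * cos (2 * pi * real k * x)) (at x within {0..1})"
      using D by (simp add: has_real_derivative_iff_has_vector_derivative)
  qed simp
  also have "F 1 - F 0 = sinh (pi * y) / pi * (y / (y^2 + real k^2))"
    using cos_2npi[of k] sin_2npi[of k] D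
    by (simp add: F_def D_def mult_ac divide_simps)
  finally show ?thesis .
qed

text \<open>This is the real part of the characteristic function of the standard normal law, after
  rescaling the variable.\<close>

lemma gaussian_cosine_transform:
  fixes s t :: real
  assumes "s > 0"
  shows "has_bochner_integral lborel (\<lambda>x. exp (- pi * s * x^2) * cos (2 * pi * t * x))
    (exp (- pi * t^2 / s) / sqrt s)"
proof -
  have m: "integrable lborel (\<lambda>x. std_normal_density x *\<^sub>R exp (\<i> * complex_of_real (u * x)))" for u
  proof -
    have "integrable lborel (\<lambda>x. complex_of_real (std_normal_density x))"
      by simp
    then show ?thesis
      by (rule Bochner_Integration.integrable_bound) (auto simp: norm_mult)
  qed
  have 1: "has_bochner_integral lborel (\<lambda>x. std_normal_density x * cos (u * x)) (exp (- (u\<^sup>2) / 2))" for u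
  proof -
    have "integral\<^sup>L lborel (\<lambda>x. std_normal_density x *\<^sub>R exp (\<i> * complex_of_real (u * x)))
       = complex_of_real (exp (- (u\<^sup>2) / 2))"
      using fun_cong[OF char_std_normal_distribution, of u]
      by (simp add: char_def integral_density cis_conv_exp)
    then have "has_bochner_integral lborel (\<lambda>x. std_normal_density x *\<^sub>R exp (\<i> * complex_of_real (u * x)))
        (complex_of_real (exp (- (u\<^sup>2) / 2)))"
      using m by (simp add: has_bochner_integral_iff)
    from has_bochner_integral_Re[OF this]
    show ?thesis by (simp add: Re_exp)
  qed
  \<comment> \<open>With this scale \<open>(c * x)^2 / 2\<close> is \<open>pi * s * x^2\<close>; the
    frequency \<open>2 * pi * t / c\<close> compensates inside the cosine.\<close>
  define c where "c = sqrt (2 * pi * s)"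
  have c: "c > 0" using assms by (simp add: c_def)
  have c2: "c^2 = 2 * pi * s" using assms by (simp add: c_def)
  have "has_bochner_integral lborel (\<lambda>x. std_normal_density (0 + c * x) * cos (2 * pi * t / c * (0 + c * x)))
     (exp (- (2 * pi * t / c)\<^sup>2 / 2) /\<^sub>R \<bar>c\<bar>)"
    using 1[of "2 * pi * t / c"] c by (subst (asm) lborel_has_bochner_integral_real_affine_iff[of c _ _ 0]) auto
  then have "has_bochner_integral lborel (\<lambda>x. sqrt (2 * pi) * (std_normal_density (0 + c * x) * cos (2 * pi * t / c * (0 + c * x))))
     (sqrt (2 * pi) * (exp (- (2 * pi * t / c)\<^sup>2 / 2) /\<^sub>R \<bar>c\<bar>))"
    by (rule has_bochner_integral_mult_right)
  also have "(\<lambda>x. sqrt (2 * pi) * (std_normal_density (0 + c * x) * cos (2 * pi * t / c * (0 + c * x))))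
     = (\<lambda>x. exp (- pi * s * x^2) * cos (2 * pi * t * x))"
    using c by (auto simp: normal_density_def fun_eq_iff power_mult_distrib c2 real_sqrt_mult mult.assoc)
  also have "sqrt (2 * pi) * (exp (- (2 * pi * t / c)\<^sup>2 / 2) /\<^sub>R \<bar>c\<bar>) = exp (- pi * t^2 / s) / sqrt s"
  proof -
    have "(2 * pi * t / c)\<^sup>2 / 2 = pi * t^2 / s"
      using assms by (simp add: power_divide power_mult_distrib c2) (simp add: field_simps power2_eq_square)
    then show ?thesis using c assms by (simp add: c_def real_sqrt_mult divide_simps)
  qed
  finally show ?thesis .
qed

section \<open>Partial fractions and theta inversion\<close>

lemma summable_inverse_add_squares:
  fixes y :: real
  assumes "y > 0"
  shows "summable (\<lambda>k. 1 / (y^2 + real k^2))"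
proof (subst summable_Suc_iff[symmetric], rule summable_comparison_test')
  show "summable (\<lambda>k. inverse (real (Suc k)^2))"
    using inverse_power_summable[of 2, where ?'a = real] by (subst summable_Suc_iff) auto
  show "norm (1 / (y^2 + real (Suc k)^2)) \<le> inverse (real (Suc k)^2)" for k
  proof -
    have "1 / (y^2 + real (Suc k)^2) \<le> 1 / (real (Suc k)^2)"
      by (intro divide_left_mono) (auto intro!: mult_pos_pos add_nonneg_pos)
    then show ?thesis by (simp add: inverse_eq_divide)
  qed
qed

text \<open>The cosine series of \<open>cosh (2 * pi * y * (x - 1/2))\<close> at the endpoint 0,
  where all cosines are 1, divided by \<open>sinh (pi * y)\<close>, is the partial fraction
  expansion of \<open>y * coth (pi * y)\<close>.\<close>

lemma planck_partial_fractions: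
  fixes y :: real
  assumes "y > 0"
  shows "y / (exp (2 * pi * y) - 1) + y / 2
    = 1 / (2 * pi) + (\<Sum>k. y^2 / (y^2 + real (Suc k)^2)) / pi"
proof -
  define c where "c k = sinh (pi * y) / pi * (y / (y^2 + real k^2))" for k
  have s0: "sinh (pi * y) > 0" using assms by simp
  have summ: "summable c"
    unfolding c_def using summable_mult[OF summable_inverse_add_squares[OF assms], of "sinh (pi * y) / pi * y"] by simp
  have c0: "c k \<ge> 0" for k
    using assms s0 by (auto simp: c_def intro!: mult_nonneg_nonneg divide_nonneg_nonneg)
  have "cosh (2 * pi * y * (0 - 1/2)) = c 0 + 2 * (\<Sum>k. c (Suc k) * cos (2 * pi * real (Suc k) * 0))"
  proof (rule cosine_series_eq)
    show "continuous_on {0..1} (\<lambda>x. cosh (2 * pi * y * (x - 1/2)))"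
      by (intro continuous_intros)
    show "cosh (2 * pi * y * (1 - x - 1/2)) = cosh (2 * pi * y * (x - 1/2))" for x
    proof -
      have "2 * pi * y * (1 - x - 1/2) = - (2 * pi * y * (x - 1/2))" by (simp add: algebra_simps)
      then show ?thesis by (simp only: cosh_minus)
    qed
    show "integral {0..1} (\<lambda>x. cosh (2 * pi * y * (x - 1/2)) * cos (2 * pi * real k * x)) = c k" for k
      unfolding c_def by (intro integral_unique has_integral_cosh_times_cos assms)
    show "summable (\<lambda>k. \<bar>c k\<bar>)" using summ c0 by simp
  qed auto
  also have "(\<lambda>k. c (Suc k) * cos (2 * pi * real (Suc k) * 0)) =
      (\<lambda>k. sinh (pi * y) / pi / y * (y^2 / (y^2 + real (Suc k)^2)))"
    using assms by (simp add: c_def fun_eq_iff power2_eq_square)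
  also have "(\<Sum>k. sinh (pi * y) / pi / y * (y^2 / (y^2 + real (Suc k)^2)))
     = sinh (pi * y) / pi / y * (\<Sum>k. y^2 / (y^2 + real (Suc k)^2))"
  proof (rule suminf_mult)
    have "summable (\<lambda>k. 1 / (y^2 + real (Suc k)^2))"
      using summable_inverse_add_squares[OF assms] by (subst summable_Suc_iff)
    from summable_mult[OF this, of "y^2"] show "summable (\<lambda>k. y^2 / (y^2 + real (Suc k)^2))" by simp
  qed
  finally have "cosh (pi * y) = sinh (pi * y) * ((1 / pi + 2 * (\<Sum>k. y^2 / (y^2 + real (Suc k)^2)) / pi) / y)"
    using assms by (simp add: c_def power2_eq_square field_simps)
  then have eq: "y * (cosh (pi * y) / sinh (pi * y)) = 1 / pi + 2 * (\<Sum>k. y^2 / (y^2 + real (Suc k)^2)) / pi"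
    using assms s0 by (simp add: field_simps)
  \<comment> \<open>In terms of \<open>E = exp (pi * y)\<close> the hyperbolic cotangent is
    \<open>(E * E + 1) / (E * E - 1)\<close>, that is, \<open>1 + 2 / (E * E - 1)\<close>.\<close>
  have "y * (cosh (pi * y) / sinh (pi * y)) = y + 2 * (y / (exp (2 * pi * y) - 1))"
  proof -
    define E where "E = exp (pi * y)"
    have E: "E > 1" using assms by (simp add: E_def)
    then have "E * E > 1" by (simp add: less_1_mult)
    have "exp (2 * pi * y) = E * E" by (simp add: E_def mult_exp_exp)
    moreover have "cosh (pi * y) = (E + 1 / E) / 2" "sinh (pi * y) = (E - 1 / E) / 2"
      by (simp_all add: E_def cosh_def sinh_def exp_minus inverse_eq_divide)
    moreover have "((E + 1 / E) / 2) / ((E - 1 / E) / 2) = (E * E + 1) / (E * E - 1)"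
      using E \<open>E * E > 1\<close> by (simp add: field_simps)
    moreover have "y * ((E * E + 1) / (E * E - 1)) = y + 2 * (y / (E * E - 1))"
      using \<open>E * E > 1\<close> by (simp add: field_simps)
    ultimately show ?thesis by (simp only:)
  qed
  with eq show ?thesis by simp
qed

text \<open>The Jacobi theta function with nome \<open>exp (- pi * s)\<close> is
  \<open>1 + 2 * omega s\<close>. Both theta sums of the theorem are values of \<open>omega\<close>,
  at \<open>a * t\<close> and at \<open>t / a\<close>.\<close>

definition omega :: "real \<Rightarrow> real" where
  "omega s = (\<Sum>n. exp (- pi * s * real (Suc n)^2))"

text \<open>From \<open>(x + n)^2 \<ge> n^2 \<ge> n\<close> comes a geometric majorant independent
  of \<open>x\<close>, as the Weierstrass test requires.\<close>

lemma gaussian_shift_le: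
  fixes s x :: real
  assumes "s > 0" "x \<ge> 0"
  shows "exp (- pi * s * (x + real n)^2) \<le> exp (- pi * s) ^ n"
proof -
  have "real n \<le> real n * real n" by (cases n) auto
  also have "\<dots> \<le> (x + real n) * (x + real n)" by (intro mult_mono) (use assms in auto)
  finally have "pi * s * real n \<le> pi * s * (x + real n)^2"
    using assms by (intro mult_left_mono) (auto simp: power2_eq_square)
  then show ?thesis by (simp add: exp_of_nat_mult[symmetric] mult_ac)
qed

lemma summable_gaussian_bound:
  fixes s :: real
  assumes "s > 0"
  shows "summable (\<lambda>n. exp (- pi * s) ^ n)"
  using assms by (intro summable_geometric) auto

lemma summable_gaussian_shift:
  fixes s x :: real
  assumes "s > 0" "x \<ge> 0"
  shows "summable (\<lambda>n. exp (- pi * s * (x + real n)^2))"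
  by (rule summable_comparison_test'[OF summable_gaussian_bound[OF assms(1)], of 0])
     (use gaussian_shift_le[OF assms] in auto)

lemma summable_omega:
  fixes s :: real
  assumes "s > 0"
  shows "summable (\<lambda>n. exp (- pi * s * real (Suc n)^2))"
  using summable_gaussian_shift[of s 1] assms by (simp add: add_ac)

text \<open>Poisson summation for the Gaussian: the cosine coefficients of its periodisation over
  one period are its cosine transform over the whole line. The resulting series is evaluated at
  0.\<close>

theorem omega_inversion:
  fixes s :: real
  assumes s: "s > 0"
  shows "1 + 2 * omega s = (1 + 2 * omega (1 / s)) / sqrt s"
proof -
  define h where "h x = exp (- pi * s * x^2)" for x
  have conth: "continuous_on A h" for A unfolding h_def by (intro continuous_intros)
  \<comment> \<open>Since \<open>h\<close> is even, the second summand is the translate by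
    \<open>-(n + 1)\<close>. This pairing covers each integer translate once and makes every
    \<open>p n\<close> symmetric about 1/2.\<close>
  define p where "p n x = h (x + real n) + h (1 - x + real n)" for n x
  define f where "f x = (\<Sum>n. p n x)" for x
  define c where "c k = exp (- pi * real k^2 / s) / sqrt s" for k :: nat
  have bound: "norm (p n x) \<le> 2 * exp (- pi * s) ^ n" if "x \<in> {0..1}" for n x
    using gaussian_shift_le[OF s, of x n] gaussian_shift_le[OF s, of "1 - x" n] that
    by (simp add: p_def h_def)
  have lim: "uniform_limit {0..1} (\<lambda>n x. \<Sum>i<n. p i x) f sequentially"
    unfolding f_def by (rule Weierstrass_m_test[OF bound summable_mult[OF summable_gaussian_bound[OF s]]])
  have contp: "continuous_on {0..1} (p n)" for n
    unfolding p_def by (intro continuous_intros continuous_on_compose2[OF conth[of UNIV]]) auto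
  have contf: "continuous_on {0..1} f"
    by (rule uniform_limit_theorem[OF _ lim]) (auto intro!: continuous_intros always_eventually contp)
  have coeff: "integral {0..1} (\<lambda>x. f x * cos (2 * pi * real k * x)) = c k" for k
  proof -
    define q where "q x = h x * cos (2 * pi * real k * x)" for x
    have contq: "continuous_on A q" for A unfolding q_def by (intro continuous_intros conth)
    have intq: "q integrable_on {u..v}" for u v by (intro integrable_continuous_interval contq)
    have q: "integrable lborel q" "integral\<^sup>L lborel q = c k"
      using gaussian_cosine_transform[OF s, of "real k"] by (simp_all add: has_bochner_integral_iff q_def[abs_def] h_def c_def)
    have pq: "p n x * cos (2 * pi * real k * x) = q (x + real n) + q (x - real (Suc n))" for n x
    proof -
      have "cos (2 * pi * real k * (x + of_int m)) = cos (2 * pi * real k * x)" for m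
      proof -
        have "2 * pi * real k * (x + of_int m) = 2 * pi * real k * x + 2 * pi * of_int (int k * m)"
          by (simp add: algebra_simps)
        also have "cos \<dots> = cos (2 * pi * real k * x)"
          using sin_integer_2pi[of "of_int (int k * m)"] cos_integer_2pi[of "of_int (int k * m)"]
          by (simp only: cos_add Ints_of_int)
        finally show ?thesis .
      qed
      moreover have "x - real (Suc n) = x + of_int (- int (Suc n))" by simp
      ultimately have "cos (2 * pi * real k * (x + real n)) = cos (2 * pi * real k * x)"
        "cos (2 * pi * real k * (x - real (Suc n))) = cos (2 * pi * real k * x)"
        by (metis of_int_of_nat_eq)+
      moreover have "h (1 - x + real n) = h (x - real (Suc n))"
        unfolding h_def by (simp add: power2_eq_square algebra_simps)
      ultimately show ?thesis by (simp only: p_def q_def distrib_right)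
    qed
    have shift: "((\<lambda>x. q (x + d)) has_integral (integral {d..1+d} q)) {0..1}" for d
      using has_integral_shift_real_ivl[OF integrable_integral[OF intq[of d "1 + d"]], of d] by simp
    \<comment> \<open>The cosine has period 1, so the translates unfold: block \<open>n\<close>
      contributes the integral of \<open>q\<close> over the two unit intervals adjoining
      \<open>[-n, n]\<close>.\<close>
    have part: "((\<lambda>x. (\<Sum>i<n. p i x) * cos (2 * pi * real k * x)) has_integral (integral {- real n..real n} q)) {0..1}" for n
    proof (induction n)
      case 0
      then show ?case by simp
    next
      case (Suc n)
      have "integral {- real (Suc n)..- real n} q + integral {- real n..real n} q = integral {- real (Suc n)..real n} q"
        "integral {- real (Suc n)..real n} q + integral {real n..real (Suc n)} q = integral {- real (Suc n)..real (Suc n)} q"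
        by ((rule Henstock_Kurzweil_Integration.integral_combine; simp add: intq), (rule Henstock_Kurzweil_Integration.integral_combine; simp add: intq))
      then have eq: "integral {- real (Suc n)..real (Suc n)} q = integral {- real n..real n} q
          + (integral {real n..1 + real n} q + integral {- real (Suc n)..1 + - real (Suc n)} q)"
        by (simp add: add_ac)
      have "(\<lambda>x. (\<Sum>i<Suc n. p i x) * cos (2 * pi * real k * x))
         = (\<lambda>x. (\<Sum>i<n. p i x) * cos (2 * pi * real k * x) + (q (x + real n) + q (x + - real (Suc n))))"
        using pq[of n] by (simp add: distrib_right del: of_nat_Suc)
      then show ?case
        unfolding eq using has_integral_add[OF Suc has_integral_add[OF shift shift]] by (simp only:)
    qed
    have lim': "uniform_limit {0..1} (\<lambda>n x. (\<Sum>i<n. p i x) * cos (2 * pi * real k * x))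
        (\<lambda>x. f x * cos (2 * pi * real k * x)) sequentially"
    proof (rule uniform_lim_mult[OF lim uniform_limit_const])
      show "bounded (f ` {0..1})"
        by (intro compact_imp_bounded compact_continuous_image contf) auto
      show "bounded ((\<lambda>x. cos (2 * pi * real k * x)) ` {0..1})"
        by (intro compact_imp_bounded compact_continuous_image continuous_intros) auto
    qed
    obtain I K where IK: "\<And>n. ((\<lambda>x. (\<Sum>i<n. p i x) * cos (2 * pi * real k * x)) has_integral I n) {0..1}"
        "((\<lambda>x. f x * cos (2 * pi * real k * x)) has_integral K) {0..1}" "I \<longlonglongrightarrow> K"
      by (rule uniform_limit_integral[OF lim']) (auto intro!: continuous_intros contp)
    have "I n = integral {- real n..real n} q" for n
      using IK(1)[of n] part[of n] by (rule has_integral_unique)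
    also have "integral {- real n..real n} q = (LBINT x:{- real n..real n}. q x)" for n
      by (rule set_borel_integral_eq_integral(2)[symmetric], unfold set_integrable_def)
         (intro integrable_mult_indicator q(1), simp)
    finally have I: "I = (\<lambda>n. LBINT x:{- real n..real n}. q x)" by auto
    have U: "(\<Union>n. {- real n..real n}) = UNIV"
    proof -
      have "\<exists>n. x \<in> {- real n..real n}" for x
      proof -
        obtain n where "\<bar>x\<bar> \<le> real n" using real_arch_simple by blast
        then have "x \<in> {- real n..real n}" by auto
        then show ?thesis by blast
      qed
      then show ?thesis by auto
    qed
    \<comment> \<open>Exhausting the line by \<open>[-n, n]\<close> identifies the coefficient with
      the full transform \<open>c k\<close>.\<close>
    have "(\<lambda>n. LBINT x:{- real n..real n}. q x) \<longlonglongrightarrow> (LBINT x:(\<Union>n. {- real n..real n}). q x)"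
      by (rule set_integral_cont_up) (auto simp: incseq_def U set_integrable_def q(1))
    also have "(LBINT x:(\<Union>n. {- real n..real n}). q x) = c k"
      by (simp only: U) (simp add: set_lebesgue_integral_def q)
    finally have "K = c k" using IK(3) unfolding I by (metis LIMSEQ_unique)
    then show ?thesis using IK(2) by (simp add: integral_unique)
  qed
  have c_eq: "c (Suc k) = exp (- pi * (1 / s) * real (Suc k)^2) / sqrt s" for k
    by (simp add: c_def)
  have "summable (\<lambda>k. c (Suc k))"
    unfolding c_eq by (intro summable_divide summable_omega) (use s in auto)
  then have summ: "summable c" by (simp only: summable_Suc_iff)
  have "f 0 = c 0 + 2 * (\<Sum>k. c (Suc k) * cos (2 * pi * real (Suc k) * 0))"
  proof (rule cosine_series_eq[OF contf _ coeff])
    show "f (1 - x) = f x" for x by (simp add: f_def p_def add.commute)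
    show "summable (\<lambda>k. \<bar>c k\<bar>)" using summ s by (simp add: c_def[abs_def])
  qed auto
  also have "(\<Sum>k. c (Suc k) * cos (2 * pi * real (Suc k) * 0)) = omega (1 / s) / sqrt s"
    unfolding omega_def c_eq using suminf_divide[OF summable_omega[of "1 / s"], of "sqrt s"] s by simp
  also have "c 0 = 1 / sqrt s" by (simp add: c_def)
  \<comment> \<open>At 0 the pair \<open>p n\<close> is \<open>h n + h (n + 1)\<close>; only the
    first sum contains the central term \<open>h 0 = 1\<close>.\<close>
  also have "f 0 = 1 + 2 * omega s"
  proof -
    have a: "summable (\<lambda>n. h (real n))" using summable_gaussian_shift[OF s, of 0] by (simp add: h_def)
    have "f 0 = (\<Sum>n. h (real n)) + (\<Sum>n. h (real (Suc n)))"
      unfolding f_def p_def using a summable_omega[OF s]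
      by (subst suminf_add) (simp_all add: h_def add_ac)
    also have "(\<Sum>n. h (real n)) = 1 + (\<Sum>n. h (real (Suc n)))"
      using suminf_split_head[OF a] by (simp add: h_def)
    finally show ?thesis by (simp add: omega_def h_def)
  qed
  finally show ?thesis by (simp add: add_divide_distrib)
qed

section \<open>Gaussian moments of the Kummer polynomials\<close>

lemma has_bochner_integral_Ici_iff_Ioi:
  fixes f :: "real \<Rightarrow> real"
  assumes [measurable]: "f \<in> borel_measurable borel"
  shows "has_bochner_integral lborel (\<lambda>x. indicator {b..} x *\<^sub>R f x) v
    \<longleftrightarrow> has_bochner_integral lborel (\<lambda>x. indicator {b<..} x *\<^sub>R f x) v"
  using AE_lborel_singleton[of b]
  by (intro has_bochner_integral_cong_AE) (auto split: split_indicator)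

lemma
  fixes f :: "real \<Rightarrow> real"
  assumes "f \<in> borel_measurable borel"
  shows set_integrable_Ici_iff_Ioi: "set_integrable lborel {b..} f \<longleftrightarrow> set_integrable lborel {b<..} f"
    and set_integral_Ici_eq_Ioi: "(LBINT x:{b..}. f x) = (LBINT x:{b<..}. f x)"
proof -
  note iff = has_bochner_integral_Ici_iff_Ioi[OF assms, of b]
  show "set_integrable lborel {b..} f \<longleftrightarrow> set_integrable lborel {b<..} f"
    using iff unfolding set_integrable_def by (simp add: integrable.simps)
  show "(LBINT x:{b..}. f x) = (LBINT x:{b<..}. f x)"
    unfolding set_lebesgue_integral_def lebesgue_integral_def iff ..
qed

lemma gaussian_moment_scale:
  fixes c M :: real and k :: nat
  assumes "c > 0"
    and "has_bochner_integral lborel (\<lambda>x::real. indicator {0..} x *\<^sub>R (exp (- x\<^sup>2) * x ^ k)) M"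
  shows "has_bochner_integral lborel (\<lambda>x. indicator {0<..} x *\<^sub>R (x ^ k * exp (- c * x\<^sup>2))) (M / sqrt c ^ Suc k)"
proof (rule has_bochner_integral_Ici_iff_Ioi[THEN iffD1, rotated])
  define r where "r = sqrt c"
  have r: "r > 0" "r\<^sup>2 = c" using assms by (auto simp: r_def)
  have "has_bochner_integral lborel (\<lambda>x. indicator {0..} (0 + r * x) *\<^sub>R (exp (- (0 + r * x)\<^sup>2) * (0 + r * x) ^ k)) (M /\<^sub>R \<bar>r\<bar>)"
    using assms(2) r by (subst (asm) lborel_has_bochner_integral_real_affine_iff[of r _ _ 0]) auto
  then have "has_bochner_integral lborel (\<lambda>x. inverse (r ^ k) *
      (indicator {0..} (0 + r * x) *\<^sub>R (exp (- (0 + r * x)\<^sup>2) * (0 + r * x) ^ k))) (inverse (r ^ k) * (M /\<^sub>R \<bar>r\<bar>))"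
    by (rule has_bochner_integral_mult_right)
  also have "inverse (r ^ k) * (M /\<^sub>R \<bar>r\<bar>) = M / r ^ Suc k"
    using r(1) by (simp add: field_simps)
  also have "(\<lambda>x. inverse (r ^ k) * (indicator {0..} (0 + r * x) *\<^sub>R (exp (- (0 + r * x)\<^sup>2) * (0 + r * x) ^ k)))
    = (\<lambda>x. indicator {0..} x *\<^sub>R (x ^ k * exp (- c * x\<^sup>2)))"
    using r by (auto simp: fun_eq_iff indicator_def zero_le_mult_iff power_mult_distrib)
  finally show "has_bochner_integral lborel (\<lambda>x. indicator {0..} x *\<^sub>R (x ^ k * exp (- c * x\<^sup>2))) (M / sqrt c ^ Suc k)"
    by (simp only: r_def)
qed measurable

text \<open>The factorial quotient in the moment is put as \<open>pochhammer (1/2) k\<close> so that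
  it cancels against the denominators of the Kummer polynomial.\<close>

lemma gaussian_moment_even_half_line:
  fixes c :: real and k :: nat
  assumes "c > 0"
  shows "has_bochner_integral lborel (\<lambda>x. indicator {0<..} x *\<^sub>R (x ^ (2 * k) * exp (- c * x\<^sup>2)))
    (sqrt pi / 2 * pochhammer (1/2) k / (c ^ k * sqrt c))"
proof -
  have "sqrt c ^ Suc (2 * k) = (sqrt c)\<^sup>2 ^ k * sqrt c"
    by (simp add: power_mult del: real_sqrt_pow2_iff)
  also have "\<dots> = c ^ k * sqrt c" using assms by (simp only: real_sqrt_pow2 less_imp_le)
  finally have "sqrt c ^ Suc (2 * k) = c ^ k * sqrt c" .
  moreover have "fact (2 * k) / (2 ^ (2 * k) * fact k) = (pochhammer (1/2) k :: real)"
    by (simp add: fact_double)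
  ultimately show ?thesis
    using gaussian_moment_scale[OF assms gaussian_moment_even_pos[of k]] by (simp only:)
qed

lemma gaussian_moment_odd_half_line:
  fixes c :: real and k :: nat
  assumes "c > 0"
  shows "has_bochner_integral lborel (\<lambda>x. indicator {0<..} x *\<^sub>R (x ^ (2 * k + 1) * exp (- c * x\<^sup>2)))
    (fact k / 2 / c ^ Suc k)"
proof -
  have "sqrt c ^ Suc (2 * k + 1) = (sqrt c ^ 2) ^ Suc k"
    by (simp only: power_mult[symmetric]) simp
  also have "\<dots> = c ^ Suc k" using assms by (simp only: real_sqrt_pow2 less_imp_le)
  finally show ?thesis
    using gaussian_moment_scale[OF assms gaussian_moment_odd_pos[of k]] by (simp only:)
qed

lemma gaussian_moment_integrable_half_line:
  fixes c :: real and n :: nat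
  assumes "c > 0"
  shows "integrable lborel (\<lambda>x. indicator {0<..} x *\<^sub>R (x ^ n * exp (- c * x\<^sup>2)))"
proof (cases "even n")
  case True
  then obtain k where "n = 2 * k" by blast
  then show ?thesis
    using gaussian_moment_even_half_line[OF assms, of k] has_bochner_integral_iff by blast
next
  case False
  then obtain k where "n = 2 * k + 1" by (rule oddE)
  then show ?thesis
    using gaussian_moment_odd_half_line[OF assms, of k] has_bochner_integral_iff by blast
qed

lemma hyp1F1_neg_nat:
  "hyp1F1 (- real m) b z = (\<Sum>j\<le>m. pochhammer (- real m) j / pochhammer b j * z ^ j / fact j)"
  unfolding hyp1F1_def
  by (rule suminf_finite) (auto simp: pochhammer_of_nat_eq_0_iff)

lemma hyp2F1_neg_nat:
  "hyp2F1 (- real m) b c z = (\<Sum>j\<le>m. pochhammer (- real m) j * pochhammer b j / pochhammer c j * z ^ j / fact j)"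
  unfolding hyp2F1_def
  by (rule suminf_finite) (auto simp: pochhammer_of_nat_eq_0_iff)

text \<open>The binomial theorem, as \<open>pochhammer (- real m) j / fact j\<close> is the binomial
  coefficient with sign \<open>(-1) ^ j\<close>.\<close>

lemma one_minus_power_pochhammer:
  fixes z :: real
  shows "(\<Sum>j\<le>m. pochhammer (- real m) j / fact j * z ^ j) = (1 - z) ^ m"
proof -
  have "(1 - z) ^ m = (- z + 1) ^ m" by simp
  also have "\<dots> = (\<Sum>j\<le>m. of_nat (m choose j) * (- z) ^ j * 1 ^ (m - j))"
    by (rule binomial_ring)
  also have "\<dots> = (\<Sum>j\<le>m. pochhammer (- real m) j / fact j * z ^ j)"
  proof (rule sum.cong)
    fix j
    have "(- 1) ^ j * (- z) ^ j = z ^ j" by (simp add: power_mult_distrib[symmetric])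
    then show "of_nat (m choose j) * (- z) ^ j * 1 ^ (m - j) = pochhammer (- real m) j / fact j * z ^ j"
      by (simp add: binomial_gbinomial gbinomial_pochhammer)
  qed simp
  finally show ?thesis by simp
qed

text \<open>The factor \<open>x^2\<close> raises the \<open>j\<close>-th moment constant to
  \<open>pochhammer (1/2) (Suc j)\<close>, which is half of \<open>pochhammer (3/2) j\<close>. It
  cancels the lower parameter 3/2 and leaves a binomial sum.\<close>

lemma gaussian_hyp1F1_square_moment:
  fixes A c :: real
  assumes "c > 0"
  shows "has_bochner_integral lborel
    (\<lambda>x. indicator {0<..} x *\<^sub>R (x\<^sup>2 * exp (- c * x\<^sup>2) * hyp1F1 (- real m) (3/2) (A * x\<^sup>2)))
    (sqrt pi / (4 * c * sqrt c) * (1 - A / c) ^ m)"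
proof -
  define b where "b j = pochhammer (- real m) j / pochhammer (3/2) j / fact j * A ^ j" for j
  have "has_bochner_integral lborel
     (\<lambda>x. \<Sum>j\<le>m. b j * (indicator {0<..} x *\<^sub>R (x ^ (2 * Suc j) * exp (- c * x\<^sup>2))))
     (\<Sum>j\<le>m. b j * (sqrt pi / 2 * pochhammer (1/2) (Suc j) / (c ^ Suc j * sqrt c)))"
    by (intro has_bochner_integral_sum has_bochner_integral_mult_right gaussian_moment_even_half_line assms)
  also have "(\<lambda>x. \<Sum>j\<le>m. b j * (indicator {0<..} x *\<^sub>R (x ^ (2 * Suc j) * exp (- c * x\<^sup>2))))
     = (\<lambda>x. indicator {0<..} x *\<^sub>R (x\<^sup>2 * exp (- c * x\<^sup>2) * hyp1F1 (- real m) (3/2) (A * x\<^sup>2)))"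
    unfolding hyp1F1_neg_nat b_def power_add power_mult
    by (auto simp: fun_eq_iff sum_distrib_left indicator_def power_mult power_mult_distrib power2_eq_square mult_ac
          intro!: sum.cong)
  also have "(\<Sum>j\<le>m. b j * (sqrt pi / 2 * pochhammer (1/2) (Suc j) / (c ^ Suc j * sqrt c)))
     = sqrt pi / (4 * c * sqrt c) * (\<Sum>j\<le>m. pochhammer (- real m) j / fact j * (A / c) ^ j)"
    unfolding sum_distrib_left
  proof (rule sum.cong)
    fix j
    have "pochhammer (1/2 :: real) (Suc j) = 1/2 * pochhammer (3/2) j"
      by (subst pochhammer_rec) simp
    then show "b j * (sqrt pi / 2 * pochhammer (1/2) (Suc j) / (c ^ Suc j * sqrt c)) =
        sqrt pi / (4 * c * sqrt c) * (pochhammer (- real m) j / fact j * (A / c) ^ j)"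
      using assms pochhammer_pos[of "3/2::real" j] by (simp add: b_def field_simps)
  qed simp
  finally show ?thesis by (simp only: one_minus_power_pochhammer)
qed

text \<open>Odd moments contribute \<open>fact j = pochhammer 1 j\<close>, the second upper
  parameter of the Gauss function.\<close>

lemma gaussian_hyp1F1_first_moment:
  fixes A c :: real
  assumes "c > 0"
  shows "has_bochner_integral lborel
    (\<lambda>x. indicator {0<..} x *\<^sub>R (x * exp (- c * x\<^sup>2) * hyp1F1 (- real m) (3/2) (A * x\<^sup>2)))
    (hyp2F1 (- real m) 1 (3/2) (A / c) / (2 * c))"
proof -
  define b where "b j = pochhammer (- real m) j / pochhammer (3/2) j / fact j * A ^ j" for j
  have "has_bochner_integral lborel
     (\<lambda>x. \<Sum>j\<le>m. b j * (indicator {0<..} x *\<^sub>R (x ^ (2 * j + 1) * exp (- c * x\<^sup>2))))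
     (\<Sum>j\<le>m. b j * (fact j / 2 / c ^ Suc j))"
    by (intro has_bochner_integral_sum has_bochner_integral_mult_right gaussian_moment_odd_half_line assms)
  also have "(\<lambda>x. \<Sum>j\<le>m. b j * (indicator {0<..} x *\<^sub>R (x ^ (2 * j + 1) * exp (- c * x\<^sup>2))))
     = (\<lambda>x. indicator {0<..} x *\<^sub>R (x * exp (- c * x\<^sup>2) * hyp1F1 (- real m) (3/2) (A * x\<^sup>2)))"
    unfolding hyp1F1_neg_nat b_def power_add power_mult
    by (auto simp: fun_eq_iff sum_distrib_left indicator_def power_mult_distrib mult_ac
          intro!: sum.cong)
  also have "(\<Sum>j\<le>m. b j * (fact j / 2 / c ^ Suc j)) = hyp2F1 (- real m) 1 (3/2) (A / c) / (2 * c)"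
    unfolding hyp2F1_neg_nat sum_divide_distrib
    by (rule sum.cong) (use assms in \<open>auto simp: b_def pochhammer_fact[symmetric] power_divide\<close>)
  finally show ?thesis .
qed

text \<open>Together with the first moment this provides the integrable majorant behind the Fubini
  argument.\<close>

lemma gaussian_hyp1F1_integrable:
  fixes A c :: real
  assumes "c > 0"
  shows "integrable lborel
    (\<lambda>x. indicator {0<..} x *\<^sub>R (exp (- c * x\<^sup>2) * hyp1F1 (- real m) (3/2) (A * x\<^sup>2)))"
proof -
  define b where "b j = pochhammer (- real m) j / pochhammer (3/2) j / fact j * A ^ j" for j
  have "integrable lborel
     (\<lambda>x. \<Sum>j\<le>m. b j * (indicator {0<..} x *\<^sub>R (x ^ (2 * j) * exp (- c * x\<^sup>2))))"
    by (intro Bochner_Integration.integrable_sum integrable_mult_right gaussian_moment_integrable_half_line assms)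
  also have "(\<lambda>x. \<Sum>j\<le>m. b j * (indicator {0<..} x *\<^sub>R (x ^ (2 * j) * exp (- c * x\<^sup>2))))
     = (\<lambda>x. indicator {0<..} x *\<^sub>R (exp (- c * x\<^sup>2) * hyp1F1 (- real m) (3/2) (A * x\<^sup>2)))"
    unfolding hyp1F1_neg_nat b_def power_add power_mult
    by (auto simp: fun_eq_iff sum_distrib_left indicator_def power_mult_distrib mult_ac
          intro!: sum.cong)
  finally show ?thesis .
qed

lemma powr_nat_plus_three_halves:
  fixes x :: real
  assumes "x > 0"
  shows "x powr (real m + 3/2) = x ^ m * (x * sqrt x)"
proof -
  have "x powr (real m + 3/2) = x powr real m * (x powr 1 * x powr (1/2))"
    by (simp only: powr_add[symmetric]) simp
  then show ?thesis using assms by (simp add: powr_realpow powr_half_sqrt)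
qed

text \<open>For \<open>m = 2 * k + 1\<close> the exponent below is \<open>2 * k + 5/2\<close>, so
  this is the weight in the error term.\<close>

definition wt :: "nat \<Rightarrow> real \<Rightarrow> real" where
  "wt m s = (s - 1) ^ m / (1 + s) powr (real m + 3/2)"

text \<open>The square moment with \<open>c = pi * a * (1 + s)\<close> and
  \<open>A = 2 * pi * a\<close>; then \<open>1 - A / c = (s - 1) / (1 + s)\<close>.\<close>

lemma wt_transform:
  fixes a s :: real
  assumes "a > 0" "s > 0"
  shows "has_bochner_integral lborel
    (\<lambda>x. indicator {0<..} x *\<^sub>R (x\<^sup>2 * exp (- pi * a * (1 + s) * x\<^sup>2) * hyp1F1 (- real m) (3/2) (2 * pi * a * x\<^sup>2)))
    (wt m s / (4 * pi * a * sqrt a))"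
proof -
  have c: "pi * a * (1 + s) > 0" using assms by simp
  have eq: "1 - (2 * pi * a) / (pi * a * (1 + s)) = (s - 1) / (1 + s)"
  proof -
    have "(2 * pi * a) / (pi * a * (1 + s)) = 2 / (1 + s)" using assms by simp
    moreover have "1 - 2 / (1 + s) = (s - 1) / (1 + s)" using assms by (simp add: field_simps)
    ultimately show ?thesis by (simp only:)
  qed
  have powr: "(1 + s) powr (real m + 3/2) = (1 + s) ^ m * (1 + s) * sqrt (1 + s)"
    using assms by (simp add: powr_nat_plus_three_halves)
  have root: "sqrt (pi * a * (1 + s)) = sqrt pi * (sqrt a * sqrt (1 + s))"
    by (simp add: real_sqrt_mult mult.assoc)
  have alg: "sqrt pi / (4 * (pi * a * q) * (sqrt pi * (b * r))) * (u / v) = u / (v * q * r) / (4 * pi * a * b)"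
    if "q > 0" "b > 0" "r > 0" "v > 0" for q b r u v :: real
    using that assms by (simp add: field_simps)
  have "sqrt pi / (4 * (pi * a * (1 + s)) * sqrt (pi * a * (1 + s))) * ((s - 1) / (1 + s)) ^ m
     = wt m s / (4 * pi * a * sqrt a)"
    unfolding wt_def powr root power_divide by (rule alg) (use assms in auto)
  with gaussian_hyp1F1_square_moment[OF c, of m "2 * pi * a"]
  have "has_bochner_integral lborel
    (\<lambda>x. indicator {0<..} x *\<^sub>R (x\<^sup>2 * exp (- (pi * a * (1 + s)) * x\<^sup>2) * hyp1F1 (- real m) (3/2) (2 * pi * a * x\<^sup>2)))
    (wt m s / (4 * pi * a * sqrt a))"
    by (simp only: eq)
  then show ?thesis by simp
qed

section \<open>Laplace transform of the theta function\<close>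

lemma has_bochner_integral_exp_half_line:
  fixes u :: real
  assumes "u > 0"
  shows "has_bochner_integral lborel (\<lambda>x. indicator {0<..} x *\<^sub>R exp (- (x * u))) (1 / u)"
  using integrable_I0i_exp_mscale[OF assms] LBINT_I0i_exp_mscale[OF assms]
  by (simp add: has_bochner_integral_iff set_integrable_def interval_lebesgue_integral_0_infty set_lebesgue_integral_def)

lemma borel_measurable_omega [measurable]: "omega \<in> borel_measurable borel"
  unfolding omega_def[abs_def] by measurable

lemma omega_nonneg: "s > 0 \<Longrightarrow> omega s \<ge> 0"
  unfolding omega_def by (intro suminf_nonneg summable_omega) auto

text \<open>Each theta term integrates to \<open>1 / (pi * a * (x^2 + n^2))\<close>. The constant
  1/2 is half the term \<open>n = 0\<close> and yields \<open>1 / (2 * pi)\<close>; the others yield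
  the partial fraction series.\<close>

lemma planck_theta_laplace:
  fixes a x :: real
  assumes a: "a > 0" and x: "x > 0"
  shows "has_bochner_integral lborel
    (\<lambda>s. indicator {0<..} s *\<^sub>R (a * x\<^sup>2 * exp (- pi * a * s * x\<^sup>2) * (1/2 + omega (a * s))))
    (x / (exp (2 * pi * x) - 1) + x / 2)"
proof -
  define F where "F y s = indicator {0<..} s *\<^sub>R exp (- (s * (pi * a * (x\<^sup>2 + y\<^sup>2))))" for y s :: real
  have pos: "pi * a * (x\<^sup>2 + y\<^sup>2) > 0" for y
    using a x by (intro mult_pos_pos add_pos_nonneg) auto
  have F: "has_bochner_integral lborel (F y) (1 / (pi * a * (x\<^sup>2 + y\<^sup>2)))" for y
    unfolding F_def by (rule has_bochner_integral_exp_half_line[OF pos])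
  have norm_F: "norm (F y s) = F y s" for y s by (simp add: F_def)
  have Fn: "F y s = indicator {0<..} s *\<^sub>R (exp (- pi * a * s * x\<^sup>2) * exp (- pi * (a * s) * y\<^sup>2))" for y s
    by (simp add: F_def mult_exp_exp algebra_simps)
  have summ: "summable (\<lambda>n. F (real (Suc n)) s)" for s
  proof (cases "s > 0")
    case True
    then have "summable (\<lambda>n. exp (- pi * (a * s) * real (Suc n)^2))"
      using a by (intro summable_omega) auto
    from summable_mult[OF this, of "exp (- pi * a * s * x\<^sup>2)"] show ?thesis
      using True by (simp add: Fn del: of_nat_Suc)
  qed (simp add: F_def)
  have sumF: "(\<Sum>n. F (real (Suc n)) s) = indicator {0<..} s *\<^sub>R (exp (- pi * a * s * x\<^sup>2) * omega (a * s))" for s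
  proof (cases "s > 0")
    case True
    then have "summable (\<lambda>n. exp (- pi * (a * s) * real (Suc n)^2))"
      using a by (intro summable_omega) auto
    from suminf_mult[OF this, of "exp (- pi * a * s * x\<^sup>2)"] show ?thesis
      using True by (simp add: Fn omega_def del: of_nat_Suc)
  qed (simp add: F_def)
  have int_val: "integral\<^sup>L lborel (F y) = 1 / (pi * a * (x\<^sup>2 + y\<^sup>2))" for y
    using F has_bochner_integral_integral_eq by blast
  have intF: "integrable lborel (F y)" for y
    using F has_bochner_integral_iff by blast
  have summ_int: "summable (\<lambda>n. 1 / (pi * a * (x\<^sup>2 + (real (Suc n))\<^sup>2)))"
  proof -
    have "summable (\<lambda>n. 1 / (x\<^sup>2 + (real (Suc n))\<^sup>2))"
      using summable_inverse_add_squares[OF x] by (subst summable_Suc_iff)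
    from summable_mult[OF this, of "1 / (pi * a)"] show ?thesis by simp
  qed
  \<comment> \<open>The terms are nonnegative, so convergence of the series of integrals justifies
    exchanging sum and integral.\<close>
  have sums: "has_bochner_integral lborel (\<lambda>s. \<Sum>n. F (real (Suc n)) s) (\<Sum>n. 1 / (pi * a * (x\<^sup>2 + (real (Suc n))\<^sup>2)))"
  proof -
    have 1: "AE s in lborel. summable (\<lambda>n. norm (F (real (Suc n)) s))"
      unfolding norm_F using summ by simp
    have 2: "summable (\<lambda>n. \<integral>s. norm (F (real (Suc n)) s) \<partial>lborel)"
      unfolding norm_F int_val by (rule summ_int)
    show ?thesis
      using integrable_suminf[OF intF 1 2] integral_suminf[OF intF 1 2]
      by (simp add: has_bochner_integral_iff int_val)
  qed
  have "has_bochner_integral lborel (\<lambda>s. a * x\<^sup>2 * (1/2 * F 0 s + (\<Sum>n. F (real (Suc n)) s)))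
     (a * x\<^sup>2 * (1/2 * (1 / (pi * a * (x\<^sup>2 + 0\<^sup>2))) + (\<Sum>n. 1 / (pi * a * (x\<^sup>2 + (real (Suc n))\<^sup>2)))))"
    by (intro has_bochner_integral_mult_right has_bochner_integral_add F sums)
  also have "(\<lambda>s. a * x\<^sup>2 * (1/2 * F 0 s + (\<Sum>n. F (real (Suc n)) s)))
     = (\<lambda>s. indicator {0<..} s *\<^sub>R (a * x\<^sup>2 * exp (- pi * a * s * x\<^sup>2) * (1/2 + omega (a * s))))"
    unfolding sumF unfolding Fn by (auto simp: fun_eq_iff indicator_def algebra_simps)
  also have "a * x\<^sup>2 * (1/2 * (1 / (pi * a * (x\<^sup>2 + 0\<^sup>2))) + (\<Sum>n. 1 / (pi * a * (x\<^sup>2 + (real (Suc n))\<^sup>2))))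
     = 1 / (2 * pi) + a * x\<^sup>2 * (\<Sum>n. 1 / (pi * a * (x\<^sup>2 + (real (Suc n))\<^sup>2)))"
    using a x by (simp add: distrib_left del: of_nat_Suc)
  also have "a * x\<^sup>2 * (\<Sum>n. 1 / (pi * a * (x\<^sup>2 + (real (Suc n))\<^sup>2)))
     = (\<Sum>n. x\<^sup>2 / (x\<^sup>2 + (real (Suc n))\<^sup>2) / pi)"
    by (subst suminf_mult[OF summ_int, symmetric]) (use a in \<open>simp add: mult.commute mult.left_commute\<close>)
  also have "\<dots> = (\<Sum>n. x\<^sup>2 / (x\<^sup>2 + (real (Suc n))\<^sup>2)) / pi"
  proof (rule suminf_divide)
    have "summable (\<lambda>n. 1 / (x\<^sup>2 + (real (Suc n))\<^sup>2))"
      using summable_inverse_add_squares[OF x] by (subst summable_Suc_iff)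
    from summable_mult[OF this, of "x\<^sup>2"] show "summable (\<lambda>n. x\<^sup>2 / (x\<^sup>2 + (real (Suc n))\<^sup>2))" by simp
  qed
  finally show ?thesis
    unfolding planck_partial_fractions[OF x] .
qed

section \<open>Folding the half-line onto its part beyond 1\<close>

text \<open>A bridge to absolutely integrable functions on sets, the setting of the change of
  variables theorem.\<close>

lemma
  fixes f :: "real \<Rightarrow> real"
  assumes "set_borel_measurable borel A f"
  shows set_integrable_lborel_iff_absolutely_integrable:
      "set_integrable lborel A f \<longleftrightarrow> f absolutely_integrable_on A"
    and set_integral_lborel_eq_integral:
      "set_integrable lborel A f \<Longrightarrow> (LBINT x:A. f x) = integral A f"
  using assms set_borel_integral_eq_integral(2)[of A f]
  by (auto simp: set_integrable_def set_borel_measurable_def integrable_completion)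

text \<open>The transformed integrand enters as a separate \<open>h\<close>, so that it can be
  supplied already simplified and with its own measurability.\<close>

lemma
  fixes f g g' h :: "real \<Rightarrow> real"
  assumes der: "\<And>x. x \<in> S \<Longrightarrow> (g has_field_derivative g' x) (at x)"
    and inj: "inj_on g S" and S: "S \<in> sets borel"
    and h: "\<And>x. x \<in> S \<Longrightarrow> \<bar>g' x\<bar> * f (g x) = h x"
    and f: "set_borel_measurable borel (g ` S) f" and hm: "set_borel_measurable borel S h"
  shows set_integrable_lborel_change_of_variables:
      "set_integrable lborel S h \<longleftrightarrow> set_integrable lborel (g ` S) f"
    and set_integral_lborel_change_of_variables:
      "set_integrable lborel S h \<Longrightarrow> (LBINT x:S. h x) = (LBINT x:g ` S. f x)"
proof -
  note conv = set_integrable_lborel_iff_absolutely_integrable set_integral_lborel_eq_integral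
  have cong: "h absolutely_integrable_on S \<longleftrightarrow> (\<lambda>x. \<bar>g' x\<bar> * f (g x)) absolutely_integrable_on S"
    "integral S h = integral S (\<lambda>x. \<bar>g' x\<bar> * f (g x))"
    by (rule set_integrable_cong, simp_all add: h) (rule integral_cong, simp add: h)
  have *: "(\<lambda>x. \<bar>g' x\<bar> * f (g x)) absolutely_integrable_on S \<and> integral S (\<lambda>x. \<bar>g' x\<bar> * f (g x)) = b
     \<longleftrightarrow> f absolutely_integrable_on (g ` S) \<and> integral (g ` S) f = b" for b
    by (rule has_absolute_integral_change_of_variables_1')
       (use S der inj in \<open>auto intro: has_field_derivative_at_within\<close>)
  show iff: "set_integrable lborel S h \<longleftrightarrow> set_integrable lborel (g ` S) f"
    using * by (auto simp: conv f hm cong)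
  assume "set_integrable lborel S h"
  then show "(LBINT x:S. h x) = (LBINT x:g ` S. f x)"
    using * iff by (auto simp: conv f hm cong)
qed

section \<open>Exchange of the Laplace and Kummer moment integrals\<close>

lemma borel_measurable_hyp1F1_neg_nat [measurable]:
  "hyp1F1 (- real m) b \<in> borel_measurable borel"
  unfolding hyp1F1_neg_nat[abs_def] by measurable

lemma borel_measurable_wt [measurable]: "wt m \<in> borel_measurable borel"
  unfolding wt_def[abs_def] by measurable

lemma planck_le:
  fixes x :: real
  assumes "x > 0"
  shows "x / (exp (2 * pi * x) - 1) \<le> 1"
proof -
  have "1 + 2 * pi * x \<le> exp (2 * pi * x)" by (rule exp_ge_add_one_self)
  moreover have "1 * x \<le> 2 * pi * x" using assms pi_gt3 by (intro mult_right_mono) auto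
  ultimately have "x \<le> exp (2 * pi * x) - 1" by linarith
  then show ?thesis using assms by (simp add: divide_le_eq)
qed

lemma
  fixes a :: real
  assumes a: "a > 0"
  shows set_integrable_theta_wt: "set_integrable lborel {0<..} (\<lambda>s. (1/2 + omega (a * s)) * wt m s)"
    and planck_hyp1F1_integral:
      "(LBINT x:{0<..}. x * exp (- pi * a * x\<^sup>2) / (exp (2 * pi * x) - 1) * hyp1F1 (- real m) (3/2) (2 * pi * a * x\<^sup>2))
       = (LBINT s:{0<..}. (1/2 + omega (a * s)) * wt m s) / (4 * pi * sqrt a)
         - hyp2F1 (- real m) 1 (3/2) 2 / (4 * pi * a)"
proof -
  define g where "g x = exp (- (pi * a) * x\<^sup>2) * hyp1F1 (- real m) (3/2) (2 * pi * a * x\<^sup>2)" for x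
  define K where "K x = x / (exp (2 * pi * x) - 1) + x / 2" for x :: real
  define L where "L x s = indicator {0<..} s *\<^sub>R (a * x\<^sup>2 * exp (- pi * a * s * x\<^sup>2) * (1/2 + omega (a * s)))" for x s
  define f where "f x s = indicator {0<..} x *\<^sub>R g x * L x s" for x s
  define Q where "Q s = (1/2 + omega (a * s)) * wt m s" for s
  have pa: "pi * a > 0" using a by simp
  have [measurable]: "g \<in> borel_measurable borel" unfolding g_def[abs_def] by measurable
  have L: "has_bochner_integral lborel (L x) (K x)" if "x > 0" for x
    using planck_theta_laplace[OF a that] unfolding L_def K_def .
  have Lnn: "L x s \<ge> 0" for x s
    using a omega_nonneg[of "a * s"] by (auto simp: L_def indicator_def)
  have Kb: "0 \<le> K x" "K x \<le> 1 + x" if "x > 0" for x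
  proof -
    have "0 \<le> x / (exp (2 * pi * x) - 1)" using that by simp
    then show "0 \<le> K x" "K x \<le> 1 + x"
      using planck_le[OF that] that unfolding K_def by linarith+
  qed
  have [measurable]: "K \<in> borel_measurable borel" unfolding K_def[abs_def] by measurable
  have [measurable]: "case_prod f \<in> borel_measurable (lborel \<Otimes>\<^sub>M lborel)"
    unfolding f_def L_def by measurable
  have g1: "has_bochner_integral lborel (\<lambda>x. indicator {0<..} x *\<^sub>R (x * g x)) (hyp2F1 (- real m) 1 (3/2) 2 / (2 * (pi * a)))"
    using gaussian_hyp1F1_first_moment[OF pa, of m "2 * pi * a"] a by (simp add: g_def mult_ac)
  have g0: "integrable lborel (\<lambda>x. indicator {0<..} x *\<^sub>R g x)"
    using gaussian_hyp1F1_integrable[OF pa, of m "2 * pi * a"] by (simp add: g_def)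
  \<comment> \<open>The bound \<open>K x \<le> 1 + x\<close> reduces this to the zeroth and first
    moments of \<open>g\<close>.\<close>
  have gK: "integrable lborel (\<lambda>x. indicator {0<..} x *\<^sub>R (g x * K x))"
  proof (rule Bochner_Integration.integrable_bound)
    show "integrable lborel (\<lambda>x. indicator {0<..} x *\<^sub>R g x + indicator {0<..} x *\<^sub>R (x * g x))"
      using g1 by (intro Bochner_Integration.integrable_add g0) (simp add: has_bochner_integral_iff)
    show "AE x in lborel. norm (indicator {0<..} x *\<^sub>R (g x * K x))
        \<le> norm (indicator {0<..} x *\<^sub>R g x + indicator {0<..} x *\<^sub>R (x * g x))"
    proof (rule AE_I2)
      fix x :: real
      show "norm (indicator {0<..} x *\<^sub>R (g x * K x))
        \<le> norm (indicator {0<..} x *\<^sub>R g x + indicator {0<..} x *\<^sub>R (x * g x))"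
      proof (cases "x > 0")
        case True
        have "\<bar>g x\<bar> * \<bar>K x\<bar> \<le> \<bar>g x\<bar> * \<bar>1 + x\<bar>"
          using Kb[OF True] by (intro mult_left_mono) auto
        moreover have "g x + x * g x = g x * (1 + x)" by (simp add: algebra_simps)
        ultimately show ?thesis using True by (simp add: abs_mult)
      qed simp
    qed
  qed measurable
  \<comment> \<open>As \<open>L\<close> is nonnegative, integrating the absolute value over
    \<open>s\<close> gives exactly the absolute value of \<open>g x * K x\<close>.\<close>
  have int_f: "integrable (lborel \<Otimes>\<^sub>M lborel) (case_prod f)"
  proof (rule lborel_pair.Fubini_integrable)
    have "(\<integral>s. norm (case_prod f (x, s)) \<partial>lborel) = norm (indicator {0<..} x *\<^sub>R (g x * K x))" for x
    proof (cases "x > 0")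
      case True
      have "(\<lambda>s. norm (case_prod f (x, s))) = (\<lambda>s. \<bar>g x\<bar> * L x s)"
        using True Lnn by (auto simp: f_def abs_mult)
      then show ?thesis
        using True L[OF True] Kb[OF True] by (simp add: has_bochner_integral_iff abs_mult)
    qed (simp add: f_def)
    then show "integrable lborel (\<lambda>x. \<integral>s. norm (case_prod f (x, s)) \<partial>lborel)"
      using integrable_norm[OF gK] by (simp only:)
    show "AE x in lborel. integrable lborel (\<lambda>s. case_prod f (x, s))"
    proof (rule AE_I2)
      fix x :: real
      show "integrable lborel (\<lambda>s. case_prod f (x, s))"
        using L[of x] by (cases "x > 0") (auto simp: f_def has_bochner_integral_iff)
    qed
  qed measurable
  have fx: "(\<integral>s. f x s \<partial>lborel) = indicator {0<..} x *\<^sub>R (g x * K x)" for x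
    using L[of x] by (cases "x > 0") (auto simp: f_def has_bochner_integral_iff)
  \<comment> \<open>For fixed \<open>s\<close> the two Gaussians merge into
    \<open>exp (- pi * a * (1 + s) * x^2)\<close>, and \<open>wt_transform\<close> applies.\<close>
  have fs: "(\<integral>x. f x s \<partial>lborel) = (indicator {0<..} s *\<^sub>R Q s) / (4 * pi * sqrt a)" for s
  proof (cases "s > 0")
    case True
    have "has_bochner_integral lborel (\<lambda>x. (a * (1/2 + omega (a * s))) * (indicator {0<..} x *\<^sub>R
        (x\<^sup>2 * exp (- pi * a * (1 + s) * x\<^sup>2) * hyp1F1 (- real m) (3/2) (2 * pi * a * x\<^sup>2))))
        ((a * (1/2 + omega (a * s))) * (wt m s / (4 * pi * a * sqrt a)))"
      by (intro has_bochner_integral_mult_right wt_transform a True)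
    also have "(\<lambda>x. (a * (1/2 + omega (a * s))) * (indicator {0<..} x *\<^sub>R
        (x\<^sup>2 * exp (- pi * a * (1 + s) * x\<^sup>2) * hyp1F1 (- real m) (3/2) (2 * pi * a * x\<^sup>2)))) = (\<lambda>x. f x s)"
    proof
      fix x
      have "exp (- pi * a * (1 + s) * x\<^sup>2) = exp (- (pi * a) * x\<^sup>2) * exp (- pi * a * s * x\<^sup>2)"
        by (simp add: mult_exp_exp algebra_simps)
      then show "(a * (1/2 + omega (a * s))) * (indicator {0<..} x *\<^sub>R
        (x\<^sup>2 * exp (- pi * a * (1 + s) * x\<^sup>2) * hyp1F1 (- real m) (3/2) (2 * pi * a * x\<^sup>2))) = f x s"
        using True unfolding f_def g_def L_def by simp
    qed
    also have "(a * (1/2 + omega (a * s))) * (wt m s / (4 * pi * a * sqrt a)) = Q s / (4 * pi * sqrt a)"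
      using a by (simp add: Q_def)
    finally show ?thesis
      using True by (simp add: has_bochner_integral_iff)
  qed (simp add: f_def L_def)
  \<comment> \<open>Fubini thus also yields integrability of theta times weight, including near 0,
    where \<open>omega\<close> is unbounded.\<close>
  have "integrable lborel (\<lambda>s. \<integral>x. f x s \<partial>lborel)"
    using int_f by (rule lborel_pair.integrable_snd)
  then have "integrable lborel (\<lambda>s. (4 * pi * sqrt a) * ((indicator {0<..} s *\<^sub>R Q s) / (4 * pi * sqrt a)))"
    unfolding fs by (rule integrable_mult_right)
  then have "integrable lborel (\<lambda>s. indicator {0<..} s *\<^sub>R Q s)" using a by simp
  then show "set_integrable lborel {0<..} (\<lambda>s. (1/2 + omega (a * s)) * wt m s)"
    by (simp add: set_integrable_def Q_def)
  have "(\<integral>x. indicator {0<..} x *\<^sub>R (g x * K x) \<partial>lborel) = (\<integral>s. (indicator {0<..} s *\<^sub>R Q s) / (4 * pi * sqrt a) \<partial>lborel)"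
    using lborel_pair.Fubini_integral[OF int_f] unfolding fx fs by simp
  also have "\<dots> = (\<integral>s. (indicator {0<..} s *\<^sub>R Q s) \<partial>lborel) / (4 * pi * sqrt a)"
    by (rule integral_divide_zero)
  finally have "has_bochner_integral lborel (\<lambda>x. indicator {0<..} x *\<^sub>R (g x * K x))
     ((LBINT s:{0<..}. Q s) / (4 * pi * sqrt a))"
    using gK by (simp add: has_bochner_integral_iff set_lebesgue_integral_def)
  \<comment> \<open>Removing the summand \<open>x / 2\<close> of \<open>K\<close> subtracts half the
    first moment, which is the Gauss function term.\<close>
  then have "has_bochner_integral lborel
     (\<lambda>x. indicator {0<..} x *\<^sub>R (g x * K x) - 1/2 * (indicator {0<..} x *\<^sub>R (x * g x)))
     ((LBINT s:{0<..}. Q s) / (4 * pi * sqrt a) - 1/2 * (hyp2F1 (- real m) 1 (3/2) 2 / (2 * (pi * a))))"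
    by (intro has_bochner_integral_diff has_bochner_integral_mult_right g1)
  also have "(\<lambda>x. indicator {0<..} x *\<^sub>R (g x * K x) - 1/2 * (indicator {0<..} x *\<^sub>R (x * g x)))
     = (\<lambda>x. indicator {0<..} x *\<^sub>R (x * exp (- pi * a * x\<^sup>2) / (exp (2 * pi * x) - 1) * hyp1F1 (- real m) (3/2) (2 * pi * a * x\<^sup>2)))"
    by (auto simp: fun_eq_iff indicator_def K_def g_def distrib_left)
  finally show "(LBINT x:{0<..}. x * exp (- pi * a * x\<^sup>2) / (exp (2 * pi * x) - 1) * hyp1F1 (- real m) (3/2) (2 * pi * a * x\<^sup>2))
       = (LBINT s:{0<..}. (1/2 + omega (a * s)) * wt m s) / (4 * pi * sqrt a)
         - hyp2F1 (- real m) 1 (3/2) 2 / (4 * pi * a)"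
    unfolding Q_def by (simp add: has_bochner_integral_iff set_lebesgue_integral_def)
qed

section \<open>Beta integral of the weight and the reflection t -> 1/t\<close>

text \<open>The substitution \<open>t = (1 + u) / (1 - u)\<close> carries the weight on
  \<open>(1, \<infinity>)\<close> to \<open>u^m * (1 - u) powr (-1/2) / sqrt 2\<close> on
  \<open>(0, 1)\<close>, a Beta integrand.\<close>

lemma
  fixes m :: nat
  shows set_integrable_wt: "set_integrable lborel {1..} (wt m)"
    and set_integral_wt: "(LBINT t:{1..}. wt m t) = sqrt (pi / 2) * Gamma (real m + 1) / Gamma (real m + 3/2)"
proof -
  define h where "h u = u powr (real m + 1 - 1) * (1 - u) powr (1/2 - 1) / sqrt 2" for u :: real
  define g where "g u = (1 + u) / (1 - u)" for u :: real
  have [measurable]: "h \<in> borel_measurable borel" unfolding h_def[abs_def] by measurable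
  have B: "(h has_integral (Beta (real m + 1) (1/2) / sqrt 2)) {0<..<1}"
    unfolding h_def[abs_def] has_integral_Icc_iff_Ioo[symmetric]
    by (intro has_integral_divide has_integral_Beta_real) auto
  have hm: "set_borel_measurable borel {0<..<1} h" unfolding set_borel_measurable_def by measurable
  have "h absolutely_integrable_on {0<..<1}"
    by (rule nonnegative_absolutely_integrable_1) (use B in \<open>auto simp: h_def\<close>)
  then have inth: "set_integrable lborel {0<..<1} h"
    by (simp add: set_integrable_lborel_iff_absolutely_integrable[OF hm])
  have valh: "(LBINT u:{0<..<1}. h u) = Beta (real m + 1) (1/2) / sqrt 2"
    using set_integral_lborel_eq_integral[OF hm inth] B by (simp add: integral_unique)
  have im: "g ` {0<..<1} = {1<..}"
  proof (intro equalityI subsetI)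
    fix t :: real assume "t \<in> {1<..}"
    then have "t = g ((t - 1) / (t + 1))" "(t - 1) / (t + 1) \<in> {0<..<1}"
      by (auto simp: g_def field_simps)
    then show "t \<in> g ` {0<..<1}" by blast
  qed (auto simp: g_def field_simps)
  have der: "(g has_field_derivative (2 / (1 - u)\<^sup>2)) (at u)" if "u \<in> {0<..<1}" for u
    unfolding g_def using that by (auto intro!: derivative_eq_intros simp: power2_eq_square)
  have inj: "inj_on g {0<..<1}"
    by (auto simp: inj_on_def g_def field_simps)
  have eq: "\<bar>2 / (1 - u)\<^sup>2\<bar> * wt m (g u) = h u" if "u \<in> {0<..<1}" for u
  proof -
    define v where "v = 1 - u"
    have v: "v > 0" "u > 0" "u = 1 - v" using that by (auto simp: v_def)
    have 1: "g u - 1 = 2 * u / v" "1 + g u = 2 / v" using v by (auto simp: g_def field_simps)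
    have "v powr (1/2 - 1) = v powr (- (1/2))" by simp
    also have "\<dots> = inverse (sqrt v)" using v by (simp only: powr_minus powr_half_sqrt less_imp_le)
    finally have q: "v powr (1/2 - 1) = inverse (sqrt v)" .
    have "wt m (g u) = (2 * u / v) ^ m / ((2 / v) ^ m * (2 / v * sqrt (2 / v)))"
      unfolding wt_def 1 using v by (subst powr_nat_plus_three_halves) auto
    also have "\<dots> = u ^ m * v * sqrt v / (2 * sqrt 2)"
      using v(1,2) by (simp add: power_divide power_mult_distrib real_sqrt_divide)
    finally have "\<bar>2 / v\<^sup>2\<bar> * wt m (g u) = u ^ m * sqrt v / (v * sqrt 2)"
      using v by (simp add: power2_eq_square)
    also have "\<dots> = u ^ m * (sqrt v / v) / sqrt 2" by simp
    also have "sqrt v / v = inverse (sqrt v)" using v(1) by (simp add: field_simps)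
    also have "u ^ m * inverse (sqrt v) / sqrt 2 = h u"
      unfolding h_def v_def[symmetric] q using v(2) by (simp add: powr_realpow)
    finally show ?thesis by (simp add: v_def)
  qed
  have fm: "set_borel_measurable borel (g ` {0<..<1}) (wt m)"
    unfolding im set_borel_measurable_def by measurable
  note cov = set_integrable_lborel_change_of_variables[OF der inj _ eq fm hm]
    set_integral_lborel_change_of_variables[OF der inj _ eq fm hm inth]
  show "set_integrable lborel {1..} (wt m)"
    using cov(1) inth by (simp add: im set_integrable_Ici_iff_Ioi)
  have "(LBINT t:{1..}. wt m t) = Beta (real m + 1) (1/2) / sqrt 2"
    using cov(2) by (simp add: im set_integral_Ici_eq_Ioi valh)
  \<comment> \<open>The factor \<open>Gamma (1/2) = sqrt pi\<close> combines with
    \<open>1 / sqrt 2\<close>.\<close>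
  also have "\<dots> = sqrt (pi / 2) * Gamma (real m + 1) / Gamma (real m + 3/2)"
    by (simp add: Beta_def Gamma_one_half_real real_sqrt_divide add_ac mult_ac)
  finally show "(LBINT t:{1..}. wt m t) = sqrt (pi / 2) * Gamma (real m + 1) / Gamma (real m + 3/2)" .
qed

lemma
  fixes a :: real
  assumes a: "a > 0"
  shows set_integrable_theta_wt_reflected: "set_integrable lborel {1..} (\<lambda>t. (1/2 + omega (t / a)) * wt m t)"
    and set_integral_theta_wt_fold:
      "(LBINT s:{0<..}. (1/2 + omega (a * s)) * wt m s)
       = (LBINT t:{1..}. (1/2 + omega (a * t)) * wt m t)
         + (-1) ^ m / sqrt a * (LBINT t:{1..}. (1/2 + omega (t / a)) * wt m t)"
proof -
  define Q where "Q s = (1/2 + omega (a * s)) * wt m s" for s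
  define R where "R t = (1/2 + omega (t / a)) * wt m t" for t
  define h where "h t = (-1) ^ m / sqrt a * R t" for t
  define g where "g t = 1 / t" for t :: real
  have [measurable]: "Q \<in> borel_measurable borel" unfolding Q_def[abs_def] by measurable
  have R [measurable]: "R \<in> borel_measurable borel" unfolding R_def[abs_def] by measurable
  have [measurable]: "h \<in> borel_measurable borel" unfolding h_def[abs_def] by measurable
  have Q: "set_integrable lborel {0<..} Q" unfolding Q_def[abs_def] by (rule set_integrable_theta_wt[OF a])
  have im: "g ` {1<..} = {0<..<1}"
  proof (intro equalityI subsetI)
    fix s :: real assume "s \<in> {0<..<1}"
    then have "s = g (1 / s)" "1 / s \<in> {1<..}" by (auto simp: g_def)
    then show "s \<in> g ` {1<..}" by blast
  qed (auto simp: g_def)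
  have der: "(g has_field_derivative (- 1 / t\<^sup>2)) (at t)" if "t \<in> {1<..}" for t
    unfolding g_def using that by (auto intro!: derivative_eq_intros simp: power2_eq_square)
  have inj: "inj_on g {1<..}" by (auto simp: inj_on_def g_def)
  have eq: "\<bar>- 1 / t\<^sup>2\<bar> * Q (g t) = h t" if "t \<in> {1<..}" for t
  proof -
    have t: "t > 0" using that by simp
    \<comment> \<open>Half of the theta inversion at \<open>a / t\<close>.\<close>
    have "1/2 + omega (a / t) = (1/2 + omega (t / a)) * (sqrt t / sqrt a)"
      using omega_inversion[of "a / t"] a t by (simp add: real_sqrt_divide field_simps)
    moreover have "wt m (1 / t) = (-1) ^ m * wt m t * (t * sqrt t)"
    proof -
      have 1: "1 / t - 1 = (-1) * ((t - 1) / t)" "1 + 1 / t = (1 + t) / t"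
        using t by (auto simp: field_simps)
      show ?thesis
        unfolding wt_def 1 power_mult_distrib power_divide using t
        by (subst powr_divide) (auto simp: powr_nat_plus_three_halves)
    qed
    \<comment> \<open>The factor \<open>sqrt t\<close> from theta and \<open>t * sqrt t\<close> from
      the weight multiply to \<open>t^2\<close>, cancelling the Jacobian.\<close>
    ultimately have "\<bar>- 1 / t\<^sup>2\<bar> * Q (g t) = h t * (sqrt t * (t * sqrt t) / t\<^sup>2)"
      by (simp add: Q_def R_def h_def g_def mult_ac)
    also have "sqrt t * (t * sqrt t) = t\<^sup>2" using t by (simp add: power2_eq_square)
    finally show ?thesis using t by simp
  qed
  have fm: "set_borel_measurable borel (g ` {1<..}) Q" and hm: "set_borel_measurable borel {1<..} h"
    unfolding im set_borel_measurable_def by measurable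
  have Q1: "set_integrable lborel {0<..<1} Q" and Q2: "set_integrable lborel {1..} Q"
    by (rule set_integrable_subset[OF Q]; force)+
  have inth: "set_integrable lborel {1<..} h"
    using set_integrable_lborel_change_of_variables[OF der inj _ eq fm hm] Q1 by (simp add: im)
  \<comment> \<open>The sign \<open>(-1) ^ m\<close> is its own inverse, so this constant undoes the
    scaling in \<open>h\<close>.\<close>
  have "set_integrable lborel {1<..} (\<lambda>t. (-1) ^ m * sqrt a * h t)"
    by (rule set_integrable_mult_right) (rule inth)
  moreover have "(\<lambda>t. (-1) ^ m * sqrt a * h t) = R"
    using a by (simp add: h_def fun_eq_iff power_mult_distrib[symmetric])
  ultimately have "set_integrable lborel {1..} R"
    using set_integrable_Ici_iff_Ioi[OF R] by simp
  then show "set_integrable lborel {1..} (\<lambda>t. (1/2 + omega (t / a)) * wt m t)"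
    by (simp add: R_def[abs_def])
  have "{0<..<1} \<union> {1..} = {0::real<..}" by auto
  then have "(LBINT s:{0<..}. Q s) = (LBINT s:{0<..<1}. Q s) + (LBINT s:{1..}. Q s)"
    using set_integral_Un[OF _ Q1 Q2] by force
  also have "(LBINT s:{0<..<1}. Q s) = (LBINT t:{1<..}. h t)"
    using set_integral_lborel_change_of_variables[OF der inj _ eq fm hm inth] by (simp add: im)
  also have "\<dots> = (-1) ^ m / sqrt a * (LBINT t:{1..}. R t)"
    unfolding h_def set_integral_Ici_eq_Ioi[OF R] by simp
  finally show "(LBINT s:{0<..}. (1/2 + omega (a * s)) * wt m s)
       = (LBINT t:{1..}. (1/2 + omega (a * t)) * wt m t)
         + (-1) ^ m / sqrt a * (LBINT t:{1..}. (1/2 + omega (t / a)) * wt m t)"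
    by (simp add: Q_def R_def)
qed

section \<open>Matching the folded integral with the closed form and the error term\<close>

theorem theorem2:
  fixes a :: real and k :: nat
  assumes "a > 0"
  shows "J_int k a = - T_term k a + eps_term k a"
proof -
  \<comment> \<open>As \<open>m\<close> is odd, the reflected integral enters with a minus sign, the
    source of the difference of the two theta sums.\<close>
  define m where "m = 2 * k + 1"
  have real_m: "real m = 2 * real k + 1" by (simp add: m_def)
  have Q: "set_integrable lborel {1..} (\<lambda>t. (1/2 + omega (a * t)) * wt m t)"
    by (rule set_integrable_subset[OF set_integrable_theta_wt[OF assms, of m]]) auto
  define W where "W = (LBINT t:{1..}. wt m t)"
  define A where "A = (LBINT t:{1..}. (1/2 + omega (a * t)) * wt m t)"
  define B where "B = (LBINT t:{1..}. (1/2 + omega (t / a)) * wt m t)"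
  have phi: "phi_theta a t = omega (a * t)" and psi: "psi_theta a t = omega (t / a)" for t
    by (simp_all add: phi_theta_def psi_theta_def omega_def mult_ac)
  have "J_int k a = (A - B / sqrt a) / (4 * pi * sqrt a) - hyp2F1 (- real m) 1 (3/2) 2 / (4 * pi * a)"
  proof -
    have "J_int k a = (LBINT x:{0<..}. x * exp (- pi * a * x\<^sup>2) / (exp (2 * pi * x) - 1) * hyp1F1 (- real m) (3/2) (2 * pi * a * x\<^sup>2))"
      by (simp only: J_int_def real_m)
    moreover have "(LBINT s:{0<..}. (1/2 + omega (a * s)) * wt m s) = A - B / sqrt a"
      unfolding set_integral_theta_wt_fold[OF assms] A_def B_def by (simp add: m_def)
    ultimately show ?thesis by (simp only: planck_hyp1F1_integral[OF assms])
  qed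
  moreover have "eps_term k a = 1 / (4 * pi * a) * (sqrt a * (A - W / 2) - (B - W / 2))"
  proof -
    \<comment> \<open>Adding and subtracting 1/2 expresses the error integral through
      \<open>A\<close>, \<open>B\<close> and \<open>W\<close>; the multiple of \<open>W\<close> left
      over is the Gamma quotient term.\<close>
    have "(sqrt a * phi_theta a t - psi_theta a t) * (t - 1) ^ (2 * k + 1) / (1 + t) powr (2 * real k + 5/2)
      = sqrt a * ((1/2 + omega (a * t)) * wt m t - wt m t * (1/2))
        - ((1/2 + omega (t / a)) * wt m t - wt m t * (1/2))" for t
    proof -
      have "(t - 1) ^ (2 * k + 1) / (1 + t) powr (2 * real k + 5/2) = wt m t"
        by (simp add: wt_def m_def add_ac)
      then show ?thesis
        unfolding phi psi times_divide_eq_right[symmetric] by (simp add: algebra_simps)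
    qed
    moreover have "(LBINT t:{1..}. sqrt a * ((1/2 + omega (a * t)) * wt m t - wt m t * (1/2))
        - ((1/2 + omega (t / a)) * wt m t - wt m t * (1/2)))
      = sqrt a * (A - W * (1/2)) - (B - W * (1/2))"
      unfolding A_def B_def W_def
      using Q set_integrable_theta_wt_reflected[OF assms, of m] set_integrable_wt[of m]
      by (simp add: set_integral_diff set_integrable_mult_left)
    ultimately show ?thesis by (simp add: eps_term_def)
  qed
  moreover have "T_term k a = 1 / (4 * pi * a) * ((1 - sqrt a) / 2 * W + hyp2F1 (- real m) 1 (3/2) 2)"
  proof -
    have "real m + 1 = 2 * real k + 2" "real m + 3/2 = 2 * real k + 5/2" by (simp_all add: real_m)
    then show ?thesis
      unfolding T_term_def W_def set_integral_wt by (simp add: real_m add_ac)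
  qed
  \<comment> \<open>Writing \<open>r\<close> for \<open>sqrt a\<close> and \<open>r * r\<close> for
    \<open>a\<close> makes the final identity a rational one.\<close>
  moreover have "(A - B / r) / (4 * pi * r) - H / (4 * pi * (r * r))
    = - (1 / (4 * pi * (r * r)) * ((1 - r) / 2 * W + H)) + 1 / (4 * pi * (r * r)) * (r * (A - W / 2) - (B - W / 2))"
    if "r > 0" for r H
    using that by (simp add: field_simps)
  from this[of "sqrt a"] have "(A - B / sqrt a) / (4 * pi * sqrt a) - H / (4 * pi * a)
    = - (1 / (4 * pi * a) * ((1 - sqrt a) / 2 * W + H)) + 1 / (4 * pi * a) * (sqrt a * (A - W / 2) - (B - W / 2))" for H
    using assms by simp
  ultimately show ?thesis by (simp only:)
qed

end
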